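(* For all integers $n\geq 0$, $\beta\geq 0$ and $k\geq 1$, the following congruences hold: \[ p_{1,5^{2k-1}}\left(5^{2k+\beta-1}n+\frac{18\cdot5^{2k+\beta-1}+5^{2k-1}+1}{24}\right)\equiv 0\pmod{5^{2k+\beta-1}}, \] \[ p_{1,5^{2k}}\left(5^{2k+2\beta-1}n+\frac{14\cdot5^{2k+2\beta-1}+5^{2k}+1}{24}\right)\equiv 0\pmod{5^{2k+\beta-1}}, \] \[ p_{1,5^{2k}}\left(5^{2k+2\beta}n+\frac{22\cdot5^{2k+2\beta}+5^{2k}+1}{24}\right)\equiv 0\pmod{5^{2k+\beta}}, \] \[ p_{1,5^{2k-1}}\left(5^{2k+\beta}n+\frac{(24r+18)\cdot5^{2k+\beta-1}+5^{2k-1}+1}{24}\right)\equiv 0\pmod{5^{2k+\beta}}\quad\text{for each } r\in\{2,3,4\}, \] and \[ p_{1,5^{2k}}\left(5^{2k+2\beta+2}n+\frac{22\cdot5^{2k+2\beta+2}+5^{2k}+1}{24}\right)\equiv 0\pmod{5^{2k+\beta+1}}. \]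
   Context: For a positive integer $\ell$, $p_{1,\ell}(n)$ denotes the number of 2-color partitions of $n$ in which one of the colors appears only in parts that are multiples of $\ell$. Its generating function is \[ \sum_{n\geq0}p_{1,\ell}(n)q^n=\frac{1}{f_1f_{\ell}},\qquad\text{where } f_r:=(q^r;q^r)_\infty=\prod_{m=1}^{\infty}(1-q^{rm}). \] *)

theory Defs
  imports
    "HOL-Number_Theory.Number_Theory"
    "HOL-Library.Multiset"
begin

(* A part of a 2-color partition is a pair (m, c) of its size m and its color c;
   the color restricted to multiples of l is True. *)

definition two_color_partitions :: "nat \<Rightarrow> nat \<Rightarrow> (nat \<times> bool) multiset set" where
  "two_color_partitions l n =
     {P. (\<forall>(m, c) \<in># P. 0 < m \<and> (c \<longrightarrow> l dvd m)) \<and> (\<Sum>(m, c) \<in># P. m) = n}"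

definition p1 :: "nat \<Rightarrow> nat \<Rightarrow> nat" where
  "p1 l n = card (two_color_partitions l n)"

(* p1 is a genuine count, not the value 0 that card assigns to infinite sets. *)
lemma finite_two_color_partitions: "finite (two_color_partitions l n)"
proof (rule finite_subset)
  show "two_color_partitions l n \<subseteq>
    (\<Union>s\<in>{..n}. {P. set_mset P \<subseteq> {0..n} \<times> UNIV \<and> size P = s})"
  proof
    fix P assume P: "P \<in> two_color_partitions l n"
    then have pos: "\<And>x. x \<in># P \<Longrightarrow> 0 < fst x" and s: "(\<Sum>x \<in># P. fst x) = n"
      by (auto simp: two_color_partitions_def case_prod_unfold)
    have "fst x \<le> n" if "x \<in># P" for x
    proof -
      from that obtain Q where "P = add_mset x Q" by (blast dest: multi_member_split)
      with s show ?thesis by simp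
    qed
    then have "set_mset P \<subseteq> {0..n} \<times> UNIV" by (auto simp: mem_Times_iff)
    moreover have "size P \<le> (\<Sum>x \<in># P. fst x)"
    proof -
      have "(\<Sum>x \<in># P. 1) \<le> (\<Sum>x \<in># P. fst x)"
        using pos by (intro sum_mset_mono) (auto simp: Suc_leI)
      then show ?thesis by simp
    qed
    ultimately show "P \<in> (\<Union>s\<in>{..n}. {P. set_mset P \<subseteq> {0..n} \<times> UNIV \<and> size P = s})"
      using s by auto
  qed
  show "finite (\<Union>s\<in>{..n}. {P. set_mset P \<subseteq> {0..n} \<times> (UNIV :: bool set) \<and> size P = s})"
    by (intro finite_UN_I, simp, fold multisets_of_size_def) (auto intro: finite_multisets_of_size)
qed

lemma power_5_mod_24: "5 ^ j mod 24 = (if even j then 1 else 5 :: nat)"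
proof (induction j)
  case 0
  show ?case by simp
next
  case (Suc j)
  have "(5::nat) ^ Suc j mod 24 = (5 * (5 ^ j mod 24)) mod 24" by (simp add: mod_mult_right_eq)
  with Suc show ?case by simp
qed

(* The divisions by 24 in the arguments of p1 are exact. *)
lemma dvd_24_odd_power:
  fixes j k r :: nat
  assumes "k \<ge> 1"
  shows "24 dvd (24 * r + 18) * 5 ^ j + 5 ^ (2 * k - 1) + 1"
    and "24 dvd 18 * 5 ^ j + 5 ^ (2 * k - 1) + (1 :: nat)"
proof -
  have "(5::nat) ^ (2 * k - 1) mod 24 = 5" using assms by (simp add: power_5_mod_24)
  moreover have "(5::nat) ^ j mod 24 = 1 \<or> (5::nat) ^ j mod 24 = 5" by (simp add: power_5_mod_24)
  ultimately show *: "24 dvd 18 * 5 ^ j + 5 ^ (2 * k - 1) + (1 :: nat)" by presburger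
  have "24 dvd 24 * (r * 5 ^ j) + (18 * 5 ^ j + 5 ^ (2 * k - 1) + (1 :: nat))"
    by (rule dvd_add[OF dvd_triv_left *])
  then show "24 dvd (24 * r + 18) * 5 ^ j + 5 ^ (2 * k - 1) + 1" by (simp add: algebra_simps)
qed

lemma dvd_24_even_power:
  fixes j k :: nat
  shows "odd j \<Longrightarrow> 24 dvd 14 * 5 ^ j + 5 ^ (2 * k) + (1 :: nat)"
    and "even j \<Longrightarrow> 24 dvd 22 * 5 ^ j + 5 ^ (2 * k) + (1 :: nat)"
proof -
  have *: "(5::nat) ^ (2 * k) mod 24 = 1" by (simp add: power_5_mod_24)
  show "24 dvd 14 * 5 ^ j + 5 ^ (2 * k) + (1 :: nat)" if "odd j"
  proof -
    have "(5::nat) ^ j mod 24 = 5" using that by (simp add: power_5_mod_24)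
    with * show ?thesis by presburger
  qed
  show "24 dvd 22 * 5 ^ j + 5 ^ (2 * k) + (1 :: nat)" if "even j"
  proof -
    have "(5::nat) ^ j mod 24 = 1" using that by (simp add: power_5_mod_24)
    with * show ?thesis by presburger
  qed
qed

end

theory Submission
  imports Defs "HOL-Computational_Algebra.Formal_Power_Series"
begin

text \<open>
  The generating function of \<open>p1 (5 ^ m)\<close> is \<open>P(q) P(q ^ (5 ^ m))\<close> with \<open>P = 1 / E\<close> and
  \<open>E = (q; q)\<close>. Passing to an arithmetic progression modulo 5 is an application of the
  operator \<open>U\<close> that keeps every fifth coefficient and is linear over power series in \<open>q ^ 5\<close>.
  With \<open>E5 = E(q ^ 5)\<close>, \<open>E25 = E(q ^ 25)\<close>, \<open>y = q E25 / E\<close> and \<open>t = q E5 ^ 6 / E ^ 6\<close>, every series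
  that occurs is \<open>P ^ 2\<close>, \<open>P P(q ^ 5)\<close> or \<open>P(q ^ 5) ^ 2\<close> times a polynomial in \<open>t\<close>, up to a factor in
  a power of \<open>q ^ 5\<close> that waits for later steps, and the steps send the polynomial \<open>x\<close> to \<open>U x\<close>,
  \<open>U (y x)\<close> or \<open>U (y ^ 2 x)\<close>.

  The dissection \<open>E = A - q E25 + C\<close> into exponents 0, 1, 2 modulo 5 satisfies \<open>A C = - (q E25) ^ 2\<close>,
  and the product of the five conjugates of \<open>E\<close> under \<open>q \<mapsto> w q\<close> (\<open>w ^ 5 = 1\<close>) is \<open>E5 ^ 6 / E25\<close>. Together
  they give \<open>t = y + 5 y ^ 2 + 15 y ^ 3 + 25 y ^ 4 + 25 y ^ 5\<close> and
  \<open>y ^ 5 = t(q ^ 5) (1 + 5 y + 15 y ^ 2 + 25 y ^ 3 + 25 y ^ 4)\<close>, hence a recurrence for \<open>U (y ^ k)\<close>. It shows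
  that the lattice spanned by the \<open>5 ^ floor ((5 j - 5) / 2) t ^ j\<close>, \<open>j \<ge> 1\<close>, is mapped into 5 times itself
  by \<open>U\<close> and \<open>U \<circ> y\<close>, and into itself by \<open>U \<circ> y ^ 2\<close>.
\<close>

section \<open>Formal power series and partitions\<close>

unbundle fps_syntax

text \<open>Congruence modulo q^N. Identities between infinite products are proved for finite
  truncations at every \<open>N\<close> and concluded by \<open>fps_eqI_agree\<close>.\<close>

definition fps_agree :: "nat \<Rightarrow> 'a fps \<Rightarrow> 'a fps \<Rightarrow> bool" where
  "fps_agree N f g \<longleftrightarrow> (\<forall>i<N. f $ i = g $ i)"

lemma fps_agree_refl [simp]: "fps_agree N f f"
  by (simp add: fps_agree_def)

lemma fps_agree_sym: "fps_agree N f g \<Longrightarrow> fps_agree N g f"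
  by (simp add: fps_agree_def)

lemma fps_agree_trans [trans]: "fps_agree N f g \<Longrightarrow> fps_agree N g h \<Longrightarrow> fps_agree N f h"
  by (simp add: fps_agree_def)

lemma fps_agree_mono: "fps_agree N f g \<Longrightarrow> M \<le> N \<Longrightarrow> fps_agree M f g"
  by (simp add: fps_agree_def)

lemma fps_agree_mult:
  fixes f g :: "'a :: comm_ring_1 fps"
  assumes "fps_agree N f f'" "fps_agree N g g'"
  shows "fps_agree N (f * g) (f' * g')"
  unfolding fps_agree_def
proof (intro allI impI)
  fix i assume "i < N"
  then show "(f * g) $ i = (f' * g') $ i"
    using assms by (auto simp: fps_mult_nth fps_agree_def intro!: sum.cong)
qed

lemma fps_agree_power:
  fixes f g :: "'a :: comm_ring_1 fps"
  assumes "fps_agree N f g"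
  shows "fps_agree N (f ^ k) (g ^ k)"
  using assms by (induction k) (auto intro: fps_agree_mult)

lemma fps_eqI_agree: "(\<And>N. fps_agree N f g) \<Longrightarrow> f = g"
  by (auto simp: fps_agree_def fps_eq_iff)

lemma fps_agree_one_minus_X_power:
  "N \<le> k \<Longrightarrow> fps_agree N (1 - fps_X ^ k) (1 :: 'a :: comm_ring_1 fps)"
  by (simp add: fps_agree_def)

section \<open>Dilations and sections of power series\<close>

definition fps_dilate :: "nat \<Rightarrow> 'a :: idom fps \<Rightarrow> 'a fps" where
  "fps_dilate l f = f oo fps_X ^ l"

lemma fps_nth_dilate:
  assumes "l > 0"
  shows "fps_dilate l f $ n = (if l dvd n then f $ (n div l) else 0)"
proof -
  have "fps_dilate l f $ n = (\<Sum>i\<in>{0..n}. if n = l * i then f $ i else 0)"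
    by (auto simp: fps_dilate_def fps_compose_nth power_mult[symmetric] intro!: sum.cong)
  also have "\<dots> = (\<Sum>i\<in>{0..n}. if i = n div l \<and> l dvd n then f $ i else 0)"
    using assms by (intro sum.cong) auto
  also have "\<dots> = (if l dvd n then f $ (n div l) else 0)"
    by (cases "l dvd n") auto
  finally show ?thesis .
qed

lemma fps_dilate_mult: "l > 0 \<Longrightarrow> fps_dilate l (f * g) = fps_dilate l f * fps_dilate l g"
  by (simp add: fps_dilate_def fps_compose_mult_distrib)

lemma fps_dilate_power: "l > 0 \<Longrightarrow> fps_dilate l (f ^ n) = fps_dilate l f ^ n"
  by (simp add: fps_dilate_def fps_compose_power)

lemma fps_dilate_prod: "l > 0 \<Longrightarrow> fps_dilate l (prod f I) = (\<Prod>i\<in>I. fps_dilate l (f i))"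
  by (simp add: fps_dilate_def fps_compose_prod_distrib)

lemma fps_dilate_1 [simp]: "fps_dilate l 1 = 1"
  by (simp add: fps_dilate_def)

lemma fps_dilate_diff: "fps_dilate l (f - g) = fps_dilate l f - fps_dilate l g"
  by (simp add: fps_dilate_def fps_compose_sub_distrib)

lemma fps_dilate_X: "l > 0 \<Longrightarrow> fps_dilate l fps_X = fps_X ^ l"
  by (simp add: fps_dilate_def)

lemma fps_dilate_one: "fps_dilate 1 f = f"
  by (simp add: fps_dilate_def)

lemma fps_dilate_dilate:
  assumes "k > 0" "l > 0"
  shows "fps_dilate k (fps_dilate l f) = fps_dilate (k * l) f"
proof (rule fps_ext)
  fix n
  have "k dvd n \<and> l dvd n div k \<longleftrightarrow> k * l dvd n"
    using assms by (metis dvd_div_iff_mult dvd_mult_left mult.commute neq0_conv)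
  then show "fps_dilate k (fps_dilate l f) $ n = fps_dilate (k * l) f $ n"
    using assms by (auto simp: fps_nth_dilate div_mult2_eq)
qed

lemma fps_agree_dilate:
  assumes "fps_agree N f g" "l > 0"
  shows "fps_agree N (fps_dilate l f) (fps_dilate l g)"
  using assms by (auto simp: fps_agree_def fps_nth_dilate intro: le_less_trans[OF div_le_dividend])

text \<open>For \<open>l = 5\<close> this is the operator U of the overview.\<close>

definition fps_section :: "nat \<Rightarrow> 'a fps \<Rightarrow> 'a fps" where
  "fps_section l f = Abs_fps (\<lambda>n. f $ (l * n))"

lemma fps_nth_section [simp]: "fps_section l f $ n = f $ (l * n)"
  by (simp add: fps_section_def)

lemma fps_section_add: "fps_section l (f + g) = fps_section l f + fps_section l g"
  by (rule fps_ext) simp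

lemma fps_section_diff:
  "fps_section l (f - g :: 'a :: group_add fps) = fps_section l f - fps_section l g"
  by (rule fps_ext) simp

lemma fps_section_0 [simp]: "fps_section l 0 = 0"
  by (rule fps_ext) simp

text \<open>Only indices divisible by \<open>l\<close> contribute to the convolution, because the
  dilated factor vanishes at all others. This is the linearity of U over series in q^l.\<close>

lemma fps_section_dilate_mult:
  assumes "l > 0"
  shows "fps_section l (fps_dilate l f * g) = f * fps_section l g"
proof (rule fps_ext)
  fix n
  have "fps_section l (fps_dilate l f * g) $ n = (\<Sum>i=0..l * n. fps_dilate l f $ i * g $ (l * n - i))"
    by (simp add: fps_mult_nth)
  also have "\<dots> = (\<Sum>i\<in>(\<lambda>j. l * j) ` {0..n}. fps_dilate l f $ i * g $ (l * n - i))"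
    using assms by (intro sum.mono_neutral_right) (auto simp: fps_nth_dilate elim!: dvdE)
  also have "\<dots> = (\<Sum>j=0..n. f $ j * g $ (l * n - l * j))"
    using assms by (subst sum.reindex) (auto simp: inj_on_def fps_nth_dilate)
  also have "\<dots> = (f * fps_section l g) $ n"
    by (simp add: fps_mult_nth diff_mult_distrib2)
  finally show "fps_section l (fps_dilate l f * g) $ n = (f * fps_section l g) $ n" .
qed

lemma fps_section_dilate: "l > 0 \<Longrightarrow> fps_section l (fps_dilate l f) = f"
  by (rule fps_ext) (simp add: fps_nth_dilate)

section \<open>The Euler function and its reciprocal\<close>

definition qpoch :: "nat \<Rightarrow> 'a :: comm_ring_1 fps" where
  "qpoch N = (\<Prod>m=1..N. 1 - fps_X ^ m)"

text \<open>The infinite product is encoded coefficientwise: factors beyond the n-th no longer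
  change the coefficient of q^n.\<close>

definition euler_fps :: "'a :: comm_ring_1 fps" where
  "euler_fps = Abs_fps (\<lambda>n. qpoch n $ n)"

lemma fps_agree_qpoch:
  assumes "N \<le> M"
  shows "fps_agree (Suc N) (qpoch M) (qpoch N :: 'a :: comm_ring_1 fps)"
  using assms
proof (induction rule: dec_induct)
  case base
  show ?case by simp
next
  case (step M)
  have "fps_agree (Suc N) (qpoch M * (1 - fps_X ^ Suc M)) (qpoch N * 1 :: 'a fps)"
    by (rule fps_agree_mult[OF step.IH fps_agree_one_minus_X_power]) (use step.hyps in simp)
  then show ?case by (simp add: qpoch_def)
qed

lemma fps_agree_euler: "fps_agree (Suc N) euler_fps (qpoch N :: 'a :: comm_ring_1 fps)"
proof (unfold fps_agree_def, intro allI impI)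
  fix i assume "i < Suc N"
  then have "fps_agree (Suc i) (qpoch N) (qpoch i :: 'a fps)" by (intro fps_agree_qpoch) simp
  then show "euler_fps $ i = (qpoch N $ i :: 'a)" by (simp add: euler_fps_def fps_agree_def)
qed

lemma fps_agree_euler_ge: "N \<le> M \<Longrightarrow> fps_agree N euler_fps (qpoch M :: 'a :: comm_ring_1 fps)"
  by (rule fps_agree_mono[OF fps_agree_euler]) simp

lemma qpoch_nth_0 [simp]: "qpoch N $ 0 = (1 :: 'a :: comm_ring_1)"
proof -
  have "fps_agree (Suc 0) (qpoch N) (qpoch 0 :: 'a fps)" by (rule fps_agree_qpoch) simp
  then show ?thesis by (simp add: fps_agree_def) (simp add: qpoch_def)
qed

lemma euler_fps_nth_0 [simp]: "euler_fps $ 0 = (1 :: 'a :: comm_ring_1)"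
  by (simp add: euler_fps_def)

text \<open>The argument 1 is the inverse of the constant coefficient, so the reciprocal exists over
  \<open>int\<close>, where divisibility by powers of 5 has content.\<close>

definition partition_fps :: "'a :: comm_ring_1 fps" where
  "partition_fps = fps_right_inverse euler_fps 1"

lemma euler_partition_fps: "euler_fps * partition_fps = (1 :: 'a :: comm_ring_1 fps)"
  unfolding partition_fps_def by (rule fps_right_inverse) simp

section \<open>Counting multisets by weight, and the generating function of
  \<open>p1\<close>\<close>

definition weighted_multisets :: "('a \<Rightarrow> nat) \<Rightarrow> 'a set \<Rightarrow> nat \<Rightarrow> 'a multiset set" where
  "weighted_multisets w S n = {P. set_mset P \<subseteq> S \<and> (\<Sum>x\<in>#P. w x) = n}"

text \<open>A multiset either avoids \<open>s\<close> or loses one copy of it; iterated, this is the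
  geometric series of 1 / (1 - q^(w s)).\<close>

lemma weighted_multisets_insert:
  assumes "w s > 0"
  shows "weighted_multisets w (insert s S) n =
    weighted_multisets w (S - {s}) n \<union>
    (if w s \<le> n then add_mset s ` weighted_multisets w (insert s S) (n - w s) else {})"
proof (intro equalityI subsetI)
  fix P assume P: "P \<in> weighted_multisets w (insert s S) n"
  show "P \<in> weighted_multisets w (S - {s}) n \<union>
    (if w s \<le> n then add_mset s ` weighted_multisets w (insert s S) (n - w s) else {})"
  proof (cases "s \<in># P")
    case True
    then obtain R where R: "P = add_mset s R" by (blast dest: multi_member_split)
    with P show ?thesis by (auto simp: weighted_multisets_def)
  next
    case False
    with P show ?thesis by (auto simp: weighted_multisets_def)
  qed
next
  fix P assume "P \<in> weighted_multisets w (S - {s}) n \<union>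
    (if w s \<le> n then add_mset s ` weighted_multisets w (insert s S) (n - w s) else {})"
  then show "P \<in> weighted_multisets w (insert s S) n"
    by (auto simp: weighted_multisets_def split: if_splits)
qed

lemma finite_weighted_multisets:
  assumes "finite S" "\<And>s. s \<in> S \<Longrightarrow> w s > 0"
  shows "finite (weighted_multisets w S n)"
  using assms
proof (induction S arbitrary: n rule: finite_induct)
  case empty
  have "weighted_multisets w {} n \<subseteq> {{#}}" by (auto simp: weighted_multisets_def)
  then show ?case by (rule finite_subset) simp
next
  case (insert s S)
  have *: "w s > 0" "S - {s} = S" using insert by auto
  have IH: "finite (weighted_multisets w S k)" for k
    using insert by auto
  show ?case
  proof (induction n rule: less_induct)
    case (less n)
    then show ?case
      using IH * by (subst weighted_multisets_insert) auto
  qed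
qed

text \<open>By \<open>weighted_multisets_insert\<close>, multiplying the counting series by
  \<open>1 - fps_X ^ w s\<close> removes \<open>s\<close> from the admissible parts, until only the
  empty multiset is left.\<close>

lemma weighted_multisets_gf:
  assumes "finite S" "\<And>s. s \<in> S \<Longrightarrow> w s > 0"
  shows "(\<Prod>s\<in>S. 1 - fps_X ^ w s) * Abs_fps (\<lambda>n. of_nat (card (weighted_multisets w S n)))
    = (1 :: 'a :: comm_ring_1 fps)"
  using assms
proof (induction S rule: finite_induct)
  case empty
  have "weighted_multisets w {} n = (if n = 0 then {{#}} else {})" for n
    by (auto simp: weighted_multisets_def)
  then show ?case by (intro fps_ext) simp
next
  case (insert s S)
  have s: "w s > 0" "S - {s} = S" using insert by auto
  have fin: "finite (weighted_multisets w (insert s S) n)" "finite (weighted_multisets w S n)" for n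
    using insert by (auto intro!: finite_weighted_multisets)
  have card: "card (weighted_multisets w (insert s S) n) = card (weighted_multisets w S n) +
    (if w s \<le> n then card (weighted_multisets w (insert s S) (n - w s)) else 0)" for n
  proof -
    let ?R = "add_mset s ` weighted_multisets w (insert s S) (n - w s)"
    have "s \<notin># P" if "P \<in> weighted_multisets w S n" for P
      using that insert.hyps(2) unfolding weighted_multisets_def by blast
    then have "weighted_multisets w S n \<inter> ?R = {}" by fastforce
    then have "card (weighted_multisets w S n \<union> ?R) = card (weighted_multisets w S n) + card ?R"
      by (intro card_Un_disjoint fin finite_imageI)
    moreover have "card ?R = card (weighted_multisets w (insert s S) (n - w s))"
      by (intro card_image) (simp add: inj_on_def)
    ultimately show ?thesis
      using weighted_multisets_insert[of w s S n] s by simp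
  qed
  have step: "(1 - fps_X ^ w s) * Abs_fps (\<lambda>n. of_nat (card (weighted_multisets w (insert s S) n)))
    = (Abs_fps (\<lambda>n. of_nat (card (weighted_multisets w S n))) :: 'a fps)"
    by (rule fps_ext) (simp add: left_diff_distrib fps_X_power_mult_nth card not_le)
  have "(\<Prod>s\<in>insert s S. 1 - fps_X ^ w s) *
      (Abs_fps (\<lambda>n. of_nat (card (weighted_multisets w (insert s S) n))) :: 'a fps) =
    (\<Prod>s\<in>S. 1 - fps_X ^ w s) * ((1 - fps_X ^ w s) *
      Abs_fps (\<lambda>n. of_nat (card (weighted_multisets w (insert s S) n))))"
    by (simp only: prod.insert[OF insert.hyps] ac_simps)
  also have "\<dots> = 1"
    unfolding step by (rule insert.IH) (use insert.prems in simp)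
  finally show ?case .
qed

lemma p1_generating_function:
  assumes "l > 0"
  shows "euler_fps * fps_dilate l euler_fps * Abs_fps (\<lambda>n. of_nat (p1 l n)) = (1 :: 'a :: idom fps)"
proof (rule fps_eqI_agree)
  fix N :: nat
  define w :: "nat \<times> bool \<Rightarrow> nat" where "w = fst"
  \<comment> \<open>Sizes up to \<open>N\<close> in the first color and \<open>l * N\<close> in the
    second include every part of a partition of \<open>n < N\<close>, so finitely many parts suffice
    below q^N.\<close>
  define S where "S = (\<lambda>m. (m, False)) ` {1..N} \<union> (\<lambda>m. (l * m, True)) ` {1..N}"
  have "fps_agree N (euler_fps * fps_dilate l euler_fps) (qpoch N * fps_dilate l (qpoch N :: 'a fps))"
    using assms by (intro fps_agree_mult fps_agree_dilate fps_agree_euler_ge) auto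
  also have "qpoch N * fps_dilate l (qpoch N :: 'a fps) = (\<Prod>s\<in>S. 1 - fps_X ^ w s)"
  proof -
    have "(\<Prod>s\<in>S. 1 - fps_X ^ w s :: 'a fps) =
      (\<Prod>s\<in>(\<lambda>m. (m, False)) ` {1..N}. 1 - fps_X ^ w s) *
      (\<Prod>s\<in>(\<lambda>m. (l * m, True)) ` {1..N}. 1 - fps_X ^ w s)"
      unfolding S_def by (rule prod.union_disjoint) auto
    also have "\<dots> = (\<Prod>m=1..N. 1 - fps_X ^ m) * (\<Prod>m=1..N. 1 - fps_X ^ (l * m))"
      using assms by (subst (1 2) prod.reindex) (auto simp: inj_on_def w_def)
    finally show ?thesis
      using assms
      by (simp add: qpoch_def fps_dilate_prod fps_dilate_diff fps_dilate_power fps_dilate_X power_mult)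
  qed
  finally have *: "fps_agree N (euler_fps * fps_dilate l euler_fps) (\<Prod>s\<in>S. 1 - fps_X ^ w s :: 'a fps)" .
  have "weighted_multisets w S n = two_color_partitions l n" if "n < N" for n
  proof (intro equalityI subsetI)
    fix P assume "P \<in> weighted_multisets w S n"
    then show "P \<in> two_color_partitions l n"
      using assms
      by (auto simp: weighted_multisets_def two_color_partitions_def S_def w_def case_prod_unfold)
  next
    fix P assume P: "P \<in> two_color_partitions l n"
    then have s: "(\<Sum>x\<in>#P. fst x) = n"
      by (auto simp: two_color_partitions_def case_prod_unfold)
    have "x \<in> S" if x: "x \<in># P" for x
    proof -
      from x obtain Q where "P = add_mset x Q" by (blast dest: multi_member_split)
      with s \<open>n < N\<close> have "fst x \<le> N" by simp
      moreover obtain m c where [simp]: "x = (m, c)" by fastforce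
      have "0 < m" "c \<longrightarrow> l dvd m"
        using P x by (auto simp: two_color_partitions_def)
      moreover have "k \<le> N" if "l * k \<le> N" for k
        using that assms by (metis mult_le_mono1 nat_mult_1 Suc_leI One_nat_def le_trans)
      ultimately show ?thesis
        by (cases c) (auto simp: S_def image_iff Suc_le_eq elim!: dvdE)
    qed
    with s show "P \<in> weighted_multisets w S n"
      by (auto simp: weighted_multisets_def w_def)
  qed
  then have **: "fps_agree N (Abs_fps (\<lambda>n. of_nat (p1 l n)))
      (Abs_fps (\<lambda>n. of_nat (card (weighted_multisets w S n))) :: 'a fps)"
    by (simp add: fps_agree_def p1_def)
  have "(\<Prod>s\<in>S. 1 - fps_X ^ w s :: 'a fps) * Abs_fps (\<lambda>n. of_nat (card (weighted_multisets w S n))) = 1"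
    using assms by (intro weighted_multisets_gf) (auto simp: S_def w_def)
  with fps_agree_mult[OF * **]
  show "fps_agree N (euler_fps * fps_dilate l euler_fps * Abs_fps (\<lambda>n. of_nat (p1 l n))) (1 :: 'a fps)"
    by simp
qed

lemma p1_fps:
  assumes "l > 0"
  shows "Abs_fps (\<lambda>n. of_nat (p1 l n)) = (partition_fps * fps_dilate l partition_fps :: 'a :: idom fps)"
proof -
  have "fps_dilate l euler_fps * fps_dilate l partition_fps = (1 :: 'a fps)"
    using assms by (simp add: fps_dilate_mult[symmetric] euler_partition_fps)
  then have "Abs_fps (\<lambda>n. of_nat (p1 l n)) = (euler_fps * partition_fps) *
    (fps_dilate l euler_fps * fps_dilate l partition_fps) * (Abs_fps (\<lambda>n. of_nat (p1 l n)) :: 'a fps)"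
    by (simp add: euler_partition_fps)
  also have "\<dots> = partition_fps * fps_dilate l partition_fps *
    (euler_fps * fps_dilate l euler_fps * Abs_fps (\<lambda>n. of_nat (p1 l n)))"
    by (simp only: ac_simps)
  finally show ?thesis by (simp add: p1_generating_function[OF assms])
qed

section \<open>The pentagonal number theorem\<close>

text \<open>The generalised pentagonal numbers. The product is even and never negative, so neither
  \<open>div\<close> nor \<open>nat\<close> loses anything.\<close>

definition pent :: "int \<Rightarrow> nat" where
  "pent k = nat (k * (3 * k - 1) div 2)"

lemma two_pent: "2 * int (pent k) = k * (3 * k - 1)"
proof -
  have "0 \<le> k * (3 * k - 1)" by (cases "k \<le> 0") (auto intro: mult_nonpos_nonpos)
  moreover have "even (k * (3 * k - 1))" by auto
  ultimately show ?thesis by (simp add: pent_def)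
qed

lemma pent_eqI: "k * (3 * k - 1) = 2 * int n \<Longrightarrow> pent k = n"
  using two_pent[of k] by linarith

text \<open>For nonzero \<open>k\<close> the factor \<open>3 * k - 1\<close> has absolute value at
  least 2. The bound makes the fibres of \<open>pent\<close> finite and confines sums to a symmetric
  interval.\<close>

lemma abs_le_pent: "\<bar>k\<bar> \<le> int (pent k)"
proof -
  have "2 * \<bar>k\<bar> \<le> k * (3 * k - 1)"
  proof (cases "k \<ge> 1")
    case True
    then have "k * 2 \<le> k * (3 * k - 1)" by (intro mult_left_mono) auto
    with True show ?thesis by simp
  next
    case False
    then have "(-k) * 2 \<le> (-k) * (1 - 3 * k)" by (cases "k = 0") (auto intro!: mult_left_mono)
    with False show ?thesis by (simp add: algebra_simps)
  qed
  with two_pent[of k] show ?thesis by linarith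
qed

lemma finite_pent: "finite {k. pent k = N}"
proof (rule finite_subset)
  show "{k. pent k = N} \<subseteq> {- int N..int N}"
  proof
    fix k assume "k \<in> {k. pent k = N}"
    then show "k \<in> {- int N..int N}" using abs_le_pent[of k] by auto
  qed
qed simp

text \<open>The summand (-1)^s (x;x)_n / (x;x)_s x^(s n + s (s + 1) / 2) of Shanks' identity, with
  the quotient written as a product so that no division occurs.\<close>

definition shanks_term :: "'a :: comm_ring_1 \<Rightarrow> nat \<Rightarrow> nat \<Rightarrow> 'a" where
  "shanks_term x n s = (-1) ^ s * (\<Prod>i=Suc s..n. 1 - x ^ i) * x ^ (s * n + \<Sum>{..s})"

lemma shanks_term_Suc:
  assumes "s \<le> n"
  shows "shanks_term x (Suc n) s = shanks_term x n s * x ^ s * (1 - x ^ Suc n)"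
  using assms by (simp add: shanks_term_def power_add algebra_simps)

text \<open>Moving the factor \<open>1 - x ^ Suc s\<close> between neighbouring summands is what
  makes the difference in \<open>n\<close> telescope.\<close>

lemma shanks_term_prev:
  assumes "s < n"
  shows "x ^ (n + Suc s) * shanks_term x n s = - (1 - x ^ Suc s) * shanks_term x n (Suc s)"
  using assms
  by (simp add: shanks_term_def prod.atLeast_Suc_atMost[of "Suc s"] power_add algebra_simps)

text \<open>Shanks' finite form of the pentagonal number theorem: the difference of the sums for
  \<open>Suc n\<close> and \<open>n\<close> telescopes.\<close>

lemma shanks_sum_Suc:
  "(\<Sum>s\<le>Suc n. shanks_term x (Suc n) s) =
   (\<Sum>s\<le>n. shanks_term x n s) +
   (-1) ^ Suc n * (x ^ (Suc n * Suc n + \<Sum>{..n}) + x ^ (Suc n * Suc n + \<Sum>{..Suc n}))"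
proof -
  \<comment> \<open>For s >= 1 this is \<open>- (1 - x ^ s) * shanks_term x n s\<close> by
    \<open>shanks_term_prev\<close>; the value 0 at \<open>s = 0\<close> continues that
    formula.\<close>
  define D where "D s = (if s = 0 then 0 else x ^ (n + s) * shanks_term x n (s - 1))" for s
  have "shanks_term x (Suc n) s - shanks_term x n s = D s - D (Suc s)" if "s \<le> n" for s
    using that shanks_term_prev[of "s - 1" n x]
    by (cases s) (auto simp: D_def shanks_term_Suc algebra_simps power_add)
  then have "(\<Sum>s\<le>n. shanks_term x (Suc n) s) - (\<Sum>s\<le>n. shanks_term x n s) = (\<Sum>s\<le>n. D s - D (Suc s))"
    by (simp add: sum_subtractf[symmetric])
  also have "\<dots> = D 0 - D (Suc n)" by (rule sum_telescope)
  also have "\<dots> = (-1) ^ Suc n * x ^ (Suc n * Suc n + \<Sum>{..n})"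
    by (simp add: D_def shanks_term_def power_add algebra_simps)
  finally show ?thesis by (simp add: shanks_term_def algebra_simps)
qed

text \<open>(-1)^k, also for negative \<open>k\<close>.\<close>

definition parity_sign :: "int \<Rightarrow> int" where
  "parity_sign k = (if even k then 1 else -1)"

lemma two_sum_atMost: "2 * \<Sum>{..n::nat} = n * Suc n"
  by (induction n) auto

text \<open>The two powers that \<open>shanks_sum_Suc\<close> adds have as exponents the pentagonal
  numbers of n + 1 and -(n + 1), the new endpoints of the interval.\<close>

lemma shanks_sum:
  "(\<Sum>s\<le>n. shanks_term x n s) = (\<Sum>k\<in>{- int n..int n}. of_int (parity_sign k) * x ^ pent k)"
proof (induction n)
  case 0
  show ?case by (simp add: shanks_term_def parity_sign_def pent_def)
next
  case (Suc n)
  have ivl: "{- int (Suc n)..int (Suc n)} = insert (int (Suc n)) (insert (- int (Suc n)) {- int n..int n})"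
    by auto
  have "2 * int (\<Sum>{..n}) = int n * int (Suc n)" "2 * int (\<Sum>{..Suc n}) = int (Suc n) * int (Suc (Suc n))"
    using two_sum_atMost[of n] two_sum_atMost[of "Suc n"] by (metis of_nat_mult of_nat_numeral)+
  then have "pent (int (Suc n)) = Suc n * Suc n + \<Sum>{..n}"
    "pent (- int (Suc n)) = Suc n * Suc n + \<Sum>{..Suc n}"
    by (auto intro!: pent_eqI simp: algebra_simps simp del: sum.atMost_Suc)
  moreover have "parity_sign (int (Suc n)) = (-1) ^ Suc n" "parity_sign (- int (Suc n)) = (-1) ^ Suc n"
    by (auto simp: parity_sign_def)
  ultimately have "(\<Sum>k\<in>{- int (Suc n)..int (Suc n)}. of_int (parity_sign k) * x ^ pent k) =
    (-1) ^ Suc n * x ^ (Suc n * Suc n + \<Sum>{..n}) + ((-1) ^ Suc n * x ^ (Suc n * Suc n + \<Sum>{..Suc n})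
    + (\<Sum>k\<in>{- int n..int n}. of_int (parity_sign k) * x ^ pent k))"
    unfolding ivl by (simp del: sum.atMost_Suc of_nat_Suc power_Suc mult_Suc mult_Suc_right)
  then show ?case
    unfolding shanks_sum_Suc Suc.IH by (simp only: distrib_left ac_simps)
qed

section \<open>The pentagonal series restricted to sets of indices\<close>

definition theta_part :: "int set \<Rightarrow> int fps" where
  "theta_part S = Abs_fps (\<lambda>N. \<Sum>k | k \<in> S \<and> pent k = N. parity_sign k)"

lemma theta_part_nth: "theta_part S $ N = (\<Sum>k | k \<in> S \<and> pent k = N. parity_sign k)"
  by (simp add: theta_part_def)

text \<open>For the coefficient of q^N, Shanks' identity is used with n = N: summands with s >= 1
  start beyond q^N, and the summand s = 0 is \<open>qpoch N\<close>.\<close>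

theorem pentagonal_number_theorem: "euler_fps = theta_part UNIV"
proof (rule fps_ext)
  fix N
  have "fps_agree (Suc N) (shanks_term fps_X N s) (0 :: int fps)" if "s \<in> {1..N}" for s
  proof -
    have "s \<le> \<Sum>{..s}" by (cases s) auto
    moreover have "N \<le> s * N" using that by simp
    ultimately have "N < s * N + \<Sum>{..s}" using that by (simp only: atLeastAtMost_iff) linarith
    then show ?thesis
      by (auto simp: fps_agree_def shanks_term_def fps_X_power_mult_right_nth)
  qed
  then have "(\<Sum>s\<in>{1..N}. shanks_term fps_X N s) $ N = (0 :: int)"
    by (simp add: fps_sum_nth fps_agree_def)
  moreover have "{..N} = insert 0 {1..N}" by auto
  ultimately have "(\<Sum>s\<le>N. shanks_term fps_X N s) $ N = (qpoch N $ N :: int)"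
    by (simp add: shanks_term_def qpoch_def)
  then have "euler_fps $ N = (\<Sum>k\<in>{- int N..int N}. of_int (parity_sign k) * fps_X ^ pent k :: int fps) $ N"
    by (simp add: euler_fps_def shanks_sum)
  also have "\<dots> = (\<Sum>k\<in>{- int N..int N}. if pent k = N then parity_sign k else 0)"
    by (auto simp: fps_sum_nth parity_sign_def intro!: sum.cong)
  also have "\<dots> = theta_part UNIV $ N"
    unfolding theta_part_nth
  proof (intro sum.mono_neutral_cong_right)
    show "{k \<in> UNIV. pent k = N} \<subseteq> {- int N..int N}"
    proof
      fix k assume "k \<in> {k \<in> UNIV. pent k = N}"
      then show "k \<in> {- int N..int N}" using abs_le_pent[of k] by auto
    qed
  qed auto
  finally show "euler_fps $ N = theta_part UNIV $ N" .
qed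

lemma theta_part_Un:
  assumes "S \<inter> T = {}"
  shows "theta_part (S \<union> T) = theta_part S + theta_part T"
proof (rule fps_ext)
  fix N
  have "{k. k \<in> S \<union> T \<and> pent k = N} = {k. k \<in> S \<and> pent k = N} \<union> {k. k \<in> T \<and> pent k = N}"
    by auto
  then show "theta_part (S \<union> T) $ N = (theta_part S + theta_part T) $ N"
    using assms finite_pent[of N] by (auto simp: theta_part_nth intro!: sum.union_disjoint)
qed

lemma finite_pent_pairs: "finite {(j, k). P j k \<and> pent j + pent k = N}"
proof (rule finite_subset)
  show "{(j, k). P j k \<and> pent j + pent k = N} \<subseteq> {- int N..int N} \<times> {- int N..int N}"
  proof clarify
    fix j k assume "N = pent j + pent k"
    with abs_le_pent[of j] abs_le_pent[of k]
    show "j \<in> {- int (pent j + pent k)..int (pent j + pent k)} \<and>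
      k \<in> {- int (pent j + pent k)..int (pent j + pent k)}" by auto
  qed
qed simp

lemma theta_part_mult_nth:
  "(theta_part S * theta_part T) $ N =
   (\<Sum>(j, k) | (j \<in> S \<and> k \<in> T) \<and> pent j + pent k = N. parity_sign j * parity_sign k)"
proof -
  let ?Z = "{(j, k). (j \<in> S \<and> k \<in> T) \<and> pent j + pent k = N}"
  have "(theta_part S * theta_part T) $ N =
    (\<Sum>i=0..N. \<Sum>(j, k) \<in> {j. j \<in> S \<and> pent j = i} \<times> {k. k \<in> T \<and> pent k = N - i}.
      parity_sign j * parity_sign k)"
    by (simp add: fps_mult_nth theta_part_nth sum_product sum.cartesian_product)
  also have "\<dots> = (\<Sum>i=0..N. \<Sum>(j, k) | (j, k) \<in> ?Z \<and> pent (fst (j, k)) = i.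
      parity_sign j * parity_sign k)"
    by (intro sum.cong) auto
  also have "\<dots> = (\<Sum>(j, k) \<in> ?Z. parity_sign j * parity_sign k)"
  proof -
    have "(\<Sum>i=0..N. \<Sum>z | z \<in> ?Z \<and> pent (fst z) = i. parity_sign (fst z) * parity_sign (snd z)) =
      (\<Sum>z \<in> ?Z. parity_sign (fst z) * parity_sign (snd z))"
      by (rule sum.group[OF finite_pent_pairs]) auto
    then show ?thesis by (simp add: case_prod_unfold)
  qed
  finally show ?thesis .
qed

text \<open>The residue is that of the index \<open>k\<close>, not of the exponent; different
  classes can share a residue of the exponent.\<close>

definition theta_class :: "int \<Rightarrow> int fps" where
  "theta_class r = theta_part {k. k mod 5 = r}"

text \<open>With \<open>x = 6m - 1\<close> and \<open>y = 6n - 1\<close>, a pair of pentagonal exponents is a Gaussian integer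
  \<open>x + iy\<close>. For \<open>x \<equiv> 2y (mod 5)\<close> it is divisible by \<open>2 + i\<close>, and conjugating the cofactor
  is an involution that preserves the norm and reverses the sign.\<close>

lemma pent_pairs_sum_zero:
  "(\<Sum>(m, n) | (3 * m + 4 * n) mod 5 = 2 \<and> pent m + pent n = N. parity_sign m * parity_sign n) = 0"
proof -
  let ?W = "{(m, n). (3 * m + 4 * n) mod 5 = (2 :: int) \<and> pent m + pent n = N}"
  \<comment> \<open>In the coordinates x, y this is the reflection (x, y) -> (-3 x - 4 y, -4 x + 3
    y) / 5, which sends (2 + i) u to -(2 + i) times the conjugate of u. The minus sign keeps both
    coordinates congruent to -1 modulo 6.\<close>
  define g :: "int \<times> int \<Rightarrow> int \<times> int"
    where "g = (\<lambda>(m, n). ((2 - 3 * m - 4 * n) div 5, (1 - 4 * m + 3 * n) div 5))"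
  have g: "g z \<in> ?W \<and> g (g z) = z \<and>
      parity_sign (fst (g z)) * parity_sign (snd (g z)) = - (parity_sign (fst z) * parity_sign (snd z))"
    if "z \<in> ?W" for z
  proof -
    obtain m n where z: "z = (m, n)" by fastforce
    have mn: "(3 * m + 4 * n) mod 5 = 2" "pent m + pent n = N" using that z by auto
    define M where "M = (2 - 3 * m - 4 * n) div 5"
    define K where "K = (1 - 4 * m + 3 * n) div 5"
    obtain c where c: "3 * m + 4 * n = 5 * c + 2"
      using mn(1) by (metis add.commute mod_mult_div_eq)
    have "2 - 3 * m - 4 * n = 5 * (- c)" using c by simp
    then have M: "5 * M = 2 - 3 * m - 4 * n"
      unfolding M_def by (metis nonzero_mult_div_cancel_left zero_neq_numeral)
    have "1 - 4 * m + 3 * n = 5 * (2 * c - 2 * m - n + 1)" using c by simp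
    then have K: "5 * K = 1 - 4 * m + 3 * n"
      unfolding K_def by (metis nonzero_mult_div_cancel_left zero_neq_numeral)
    have "25 * (M * (3 * M - 1) + K * (3 * K - 1)) = 25 * (m * (3 * m - 1) + n * (3 * n - 1))"
    proof -
      have "25 * (M * (3 * M - 1) + K * (3 * K - 1)) = 3 * ((5 * M)\<^sup>2 + (5 * K)\<^sup>2) - 5 * (5 * M + 5 * K)"
        by (simp add: algebra_simps power2_eq_square)
      also have "\<dots> = 25 * (m * (3 * m - 1) + n * (3 * n - 1))"
        unfolding M K by (simp add: algebra_simps power2_eq_square)
      finally show ?thesis .
    qed
    then have "25 * (2 * int (pent M) + 2 * int (pent K)) = 25 * (2 * int (pent m) + 2 * int (pent n))"
      unfolding two_pent .
    then have "int (pent M + pent K) = int (pent m + pent n)" by simp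
    then have N: "pent M + pent K = N" using mn(2) by (simp only: of_nat_eq_iff)
    have MK: "3 * M + 4 * K = 2 - 5 * m" "1 - 4 * M + 3 * K = 5 * n" using M K by linarith+
    have "5 * (M + K) = 5 * M + 5 * K" by simp
    also have "\<dots> = 3 - 7 * m - n" unfolding M K by simp
    finally have "5 * (M + K) = 3 - 7 * m - n" .
    then have "even (5 * (M + K)) \<longleftrightarrow> even (3 - 7 * m - n)" by (simp only:)
    then have "even (M + K) \<longleftrightarrow> odd (m + n)" by auto
    moreover have "(2 - 5 * m) mod 5 = 2"
      using mod_mult_self2[of 2 5 "- m"] by simp
    ultimately show ?thesis
      using N MK z unfolding g_def by (auto simp: M_def[symmetric] K_def[symmetric] parity_sign_def)
  qed
  let ?h = "\<lambda>z. parity_sign (fst z) * parity_sign (snd z)"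
  have "sum ?h ?W = sum (\<lambda>z. - ?h z) ?W"
    by (rule sum.reindex_bij_witness[where i = g and j = g]) (use g in fastforce)+
  then show ?thesis by (simp add: sum_negf case_prod_unfold)
qed

text \<open>The vanishing sum over pairs is sorted by the residue r of the second index, which
  forces the residue 2 r + 4 of the first.\<close>

lemma theta_class_products:
  "theta_class 4 * theta_class 0 + theta_class 1 * theta_class 1 + theta_class 3 * theta_class 2
   + theta_class 0 * theta_class 3 + theta_class 2 * theta_class 4 = 0"
proof (rule fps_ext)
  fix N
  let ?W = "{(m, n). (3 * m + 4 * n) mod 5 = (2 :: int) \<and> pent m + pent n = N}"
  let ?h = "\<lambda>z. parity_sign (fst z) * parity_sign (snd z)"
  have "sum ?h {z \<in> ?W. snd z mod 5 = r} = (theta_class ((2 * r + 4) mod 5) * theta_class r) $ N"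
    if "r \<in> {0..4}" for r
  proof -
    have "(3 * m + 4 * n) mod 5 = 2 \<and> n mod 5 = r \<longleftrightarrow> m mod 5 = (2 * r + 4) mod 5 \<and> n mod 5 = r"
      for m n :: int
    proof -
      have "(3 * m + 4 * n) mod 5 = 2 mod 5 \<longleftrightarrow> 5 dvd 3 * m + 4 * n - 2"
        by (rule mod_eq_dvd_iff)
      also have "\<dots> \<longleftrightarrow> 5 dvd m - (2 * n + 4)"
      proof
        assume "5 dvd 3 * m + 4 * n - 2"
        then obtain c where "3 * m + 4 * n - 2 = 5 * c" ..
        then have "m - (2 * n + 4) = 5 * (2 * c - m - 2 * n)" by simp
        then show "5 dvd m - (2 * n + 4)" ..
      next
        assume "5 dvd m - (2 * n + 4)"
        then obtain c where "m - (2 * n + 4) = 5 * c" ..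
        then have "3 * m + 4 * n - 2 = 5 * (3 * c + 2 * n + 2)" by simp
        then show "5 dvd 3 * m + 4 * n - 2" ..
      qed
      also have "\<dots> \<longleftrightarrow> m mod 5 = (2 * n + 4) mod 5"
        by (rule mod_eq_dvd_iff[symmetric])
      also have "(2 * n + 4) mod 5 = (2 * (n mod 5) + 4) mod 5"
        by (rule mod_add_cong[OF mod_mult_cong]) simp_all
      finally show ?thesis by auto
    qed
    then have "(m, n) \<in> {z \<in> ?W. snd z mod 5 = r} \<longleftrightarrow>
      (m mod 5 = (2 * r + 4) mod 5 \<and> n mod 5 = r) \<and> pent m + pent n = N" for m n
      by (simp only: mem_Collect_eq case_prod_conv snd_conv) blast
    then have "{z \<in> ?W. snd z mod 5 = r} =
      {(j, k). (j \<in> {j. j mod 5 = (2 * r + 4) mod 5} \<and> k \<in> {k. k mod 5 = r}) \<and> pent j + pent k = N}"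
      by (simp only: set_eq_iff split_paired_All mem_Collect_eq case_prod_conv) blast
    then show ?thesis
      by (simp add: theta_class_def theta_part_mult_nth case_prod_unfold)
  qed
  moreover have "(\<Sum>r\<in>{0..4}. sum ?h {z \<in> ?W. snd z mod 5 = r}) = sum ?h ?W"
    by (rule sum.group[OF finite_pent_pairs]) auto
  moreover have "sum ?h ?W = 0"
    using pent_pairs_sum_zero[of N] by (simp add: case_prod_unfold)
  ultimately have "(\<Sum>r\<in>{0..4}. (theta_class ((2 * r + 4) mod 5) * theta_class r) $ N) = 0"
    by simp
  moreover have "{0..4} = {0, 1, 2, 3, 4 :: int}" by auto
  ultimately show "(theta_class 4 * theta_class 0 + theta_class 1 * theta_class 1
    + theta_class 3 * theta_class 2 + theta_class 0 * theta_class 3 + theta_class 2 * theta_class 4) $ N = 0 $ N"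
    by simp
qed

lemma euler_eq_theta_classes:
  "euler_fps = theta_class 0 + theta_class 1 + theta_class 2 + theta_class 3 + theta_class 4"
proof -
  have "(UNIV :: int set) = {k. k mod 5 = 0} \<union> {k. k mod 5 = 1} \<union> {k. k mod 5 = 2}
    \<union> {k. k mod 5 = 3} \<union> {k. k mod 5 = 4}"
    by auto
  then have "euler_fps = theta_part ({k. k mod 5 = 0} \<union> {k. k mod 5 = 1} \<union> {k. k mod 5 = 2}
    \<union> {k. k mod 5 = 3} \<union> {k. k mod 5 = 4})"
    by (simp add: pentagonal_number_theorem)
  also have "\<dots> = theta_class 0 + theta_class 1 + theta_class 2 + theta_class 3 + theta_class 4"
    unfolding theta_class_def by (subst theta_part_Un, force)+ (rule refl)
  finally show ?thesis .
qed

text \<open>The substitution k -> 1 - 5 k turns the exponent into 1 + 25 \<open>pent k\<close> and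
  reverses the sign, so this class is a copy of the whole pentagonal series in q^25.\<close>

lemma theta_class_1: "theta_class 1 = - (fps_X * fps_dilate 25 euler_fps)"
proof (rule fps_ext)
  fix N
  have pent1: "pent (1 - 5 * k) = 1 + 25 * pent k" for k
    using two_pent[of k] by (intro pent_eqI) (simp add: algebra_simps)
  show "theta_class 1 $ N = (- (fps_X * fps_dilate 25 euler_fps)) $ N"
  proof (cases "N mod 25 = 1")
    case True
    then obtain M where M: "N = 1 + 25 * M" by (metis add.commute mult_div_mod_eq)
    have "theta_class 1 $ N = (\<Sum>k | k \<in> UNIV \<and> pent k = M. - parity_sign k)"
      unfolding theta_class_def theta_part_nth
    proof (rule sum.reindex_bij_witness[where i = "\<lambda>k. 1 - 5 * k" and j = "\<lambda>k. (1 - k) div 5"])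
      fix k assume "k \<in> {k. k \<in> {k. k mod 5 = 1} \<and> pent k = N}"
      then have k: "k mod 5 = 1" "pent k = N" by auto
      then show *: "1 - 5 * ((1 - k) div 5) = k" by presburger
      from k show "(1 - k) div 5 \<in> {k \<in> UNIV. pent k = M}"
        using pent1[of "(1 - k) div 5"] M unfolding * by simp
      have "even k \<longleftrightarrow> odd ((1 - k) div 5)" using * by presburger
      then show "- parity_sign ((1 - k) div 5) = parity_sign k"
        by (auto simp: parity_sign_def)
    next
      fix k assume "k \<in> {k \<in> UNIV. pent k = M}"
      then show "1 - 5 * k \<in> {k. k \<in> {k. k mod 5 = 1} \<and> pent k = N}" "(1 - (1 - 5 * k)) div 5 = k"
        using pent1[of k] M by (simp_all, presburger)
    qed
    also have "\<dots> = - (euler_fps $ M)"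
      by (simp add: pentagonal_number_theorem theta_part_nth sum_negf)
    finally show ?thesis using M by (simp add: fps_nth_dilate)
  next
    case False
    have "pent k \<noteq> N" if "k mod 5 = 1" for k
    proof
      assume "pent k = N"
      moreover have "k = 1 - 5 * ((1 - k) div 5)" using that by presburger
      ultimately have "N = 1 + 25 * pent ((1 - k) div 5)" using pent1 by metis
      with False show False by simp
    qed
    then have "theta_class 1 $ N = 0"
      unfolding theta_class_def theta_part_nth by (intro sum.neutral) auto
    \<comment> \<open>At \<open>N = 0\<close> the truncated \<open>N - 1\<close> is divisible by 25,
      but there the factor \<open>fps_X\<close> already gives 0.\<close>
    moreover have "\<not> 25 dvd N - 1" if "N \<noteq> 0"
    proof
      assume "25 dvd N - 1"
      then obtain c where "N - 1 = 25 * c" ..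
      with that have "N = 1 + 25 * c" by simp
      with False show False by simp
    qed
    ultimately show ?thesis by (auto simp: fps_nth_dilate)
  qed
qed

lemma theta_class_supp:
  assumes "theta_class r $ N \<noteq> 0"
  obtains k where "k mod 5 = r" "2 * int N = k * (3 * k - 1)"
proof -
  have "\<exists>k. k mod 5 = r \<and> pent k = N"
  proof (rule ccontr)
    assume "\<nexists>k. k mod 5 = r \<and> pent k = N"
    then have "theta_class r $ N = 0"
      unfolding theta_class_def theta_part_nth by (intro sum.neutral) auto
    with assms show False by simp
  qed
  then obtain k where "k mod 5 = r" "pent k = N" by blast
  with two_pent[of k] that show ?thesis by simp
qed

section \<open>The 5-dissection of the Euler function\<close>

text \<open>\<open>r\<close> is reduced only inside the definition, so that it simply adds when
  series are multiplied.\<close>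

definition fps_supp :: "nat \<Rightarrow> 'a :: zero fps \<Rightarrow> bool" where
  "fps_supp r f \<longleftrightarrow> (\<forall>n. f $ n \<noteq> 0 \<longrightarrow> n mod 5 = r mod 5)"

lemma fps_supp_add:
  "fps_supp r f \<Longrightarrow> fps_supp r g \<Longrightarrow> fps_supp r (f + g :: 'a :: monoid_add fps)"
  unfolding fps_supp_def fps_add_nth by (metis add.right_neutral)

lemma fps_supp_mult:
  fixes f g :: "'a :: comm_ring_1 fps"
  assumes "fps_supp r f" "fps_supp s g"
  shows "fps_supp (r + s) (f * g)"
  unfolding fps_supp_def
proof (intro allI impI)
  fix n assume "(f * g) $ n \<noteq> 0"
  then have "\<not> (\<forall>i\<in>{0..n}. f $ i * g $ (n - i) = 0)"
    unfolding fps_mult_nth by (meson sum.neutral)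
  then obtain i where i: "i \<le> n" "f $ i * g $ (n - i) \<noteq> 0"
    by auto
  then have "f $ i \<noteq> 0" "g $ (n - i) \<noteq> 0" by auto
  then have "i mod 5 = r mod 5" "(n - i) mod 5 = s mod 5"
    using assms unfolding fps_supp_def by blast+
  then have "(i + (n - i)) mod 5 = (r + s) mod 5" by (rule mod_add_cong)
  with i show "n mod 5 = (r + s) mod 5" by simp
qed

lemma fps_supp_1: "fps_supp 0 1"
  by (simp add: fps_supp_def)

lemma fps_supp_power:
  fixes f :: "'a :: comm_ring_1 fps"
  assumes "fps_supp r f"
  shows "fps_supp (k * r) (f ^ k)"
  by (induction k) (auto simp: fps_supp_1 intro: fps_supp_mult assms)

lemma fps_supp_dilate: "5 dvd l \<Longrightarrow> l > 0 \<Longrightarrow> fps_supp 0 (fps_dilate l f)"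
  unfolding fps_supp_def fps_nth_dilate by (metis dvd_trans mod_0 dvd_eq_mod_eq_0)

lemma fps_supp_X: "fps_supp 1 (fps_X :: 'a :: comm_ring_1 fps)"
  by (simp add: fps_supp_def fps_X_def)

text \<open>The generalised pentagonal numbers are 0, 1 or 2 modulo 5.\<close>

definition A_part :: "int fps" where "A_part = theta_class 0 + theta_class 2"
definition B_part :: "int fps" where "B_part = fps_X * fps_dilate 25 euler_fps"
definition C_part :: "int fps" where "C_part = theta_class 3 + theta_class 4"

lemma euler_dissection: "euler_fps = A_part - B_part + C_part"
  using theta_class_1 by (simp add: euler_eq_theta_classes A_part_def B_part_def C_part_def)

text \<open>Expanding \<open>A_part * C_part\<close> yields four of the five products in
  \<open>theta_class_products\<close>; the fifth is the square of
  \<open>theta_class 1\<close>.\<close>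

lemma A_mult_C: "A_part * C_part = - (B_part ^ 2)"
proof -
  have "A_part * C_part + theta_class 1 * theta_class 1 = 0"
    using theta_class_products by (simp add: A_part_def C_part_def algebra_simps)
  then show ?thesis
    unfolding theta_class_1 B_part_def[symmetric]
    by (simp add: power2_eq_square eq_neg_iff_add_eq_0)
qed

text \<open>Twice the exponent is a polynomial in the index, hence the doubled residues; at the end
  3 inverts 2 modulo 5.\<close>

lemma fps_supp_theta_class:
  assumes "r * (3 * r - 1) mod 5 = int (2 * s) mod 5"
  shows "fps_supp s (theta_class r)"
  unfolding fps_supp_def
proof (intro allI impI)
  fix N assume "theta_class r $ N \<noteq> 0"
  then obtain k where k: "k mod 5 = r" "2 * int N = k * (3 * k - 1)"
    by (rule theta_class_supp)
  have "int (2 * N) mod 5 = k * (3 * k - 1) mod 5" using k by simp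
  also have "\<dots> = r * (3 * r - 1) mod 5"
    by (rule mod_mult_cong[OF _ mod_diff_cong[OF mod_mult_cong]]) (use k in auto)
  also note assms
  finally have "int (2 * N mod 5) = int (2 * s mod 5)" by (simp add: zmod_int)
  then have *: "2 * N mod 5 = 2 * s mod 5" by (rule of_nat_eq_iff[THEN iffD1])
  have M: "M mod 5 = 3 * (2 * M) mod 5" for M :: nat
    using mod_mult_self1[of M M 5] by (simp add: mult.commute)
  have "N mod 5 = 3 * (2 * N) mod 5" by (rule M)
  also have "\<dots> = 3 * (2 * s) mod 5" by (intro mod_mult_cong refl *)
  also have "\<dots> = s mod 5" by (rule M[symmetric])
  finally show "N mod 5 = s mod 5" .
qed

lemma fps_supp_A_part: "fps_supp 0 A_part"
  unfolding A_part_def by (intro fps_supp_add fps_supp_theta_class) auto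

lemma fps_supp_B_part: "fps_supp 1 B_part"
  unfolding B_part_def using fps_supp_mult[OF fps_supp_X fps_supp_dilate[of 25 euler_fps]] by simp

lemma fps_supp_C_part: "fps_supp 2 C_part"
  unfolding C_part_def by (intro fps_supp_add fps_supp_theta_class) auto

text \<open>The five factors are the conjugates of A + B + C when the exponents lie in the classes
  0, 1, 2. Pairing the factors for w^i and w^(-i) leaves only the Gaussian periods \<open>s\<close>
  and \<open>t\<close>, whose sum and product are both -1.\<close>

lemma cyclotomic_norm:
  fixes w A B C :: "'a :: idom"
  assumes w: "1 + w + w ^ 2 + w ^ 3 + w ^ 4 = 0"
  shows "(A + B + C) * (A + w * B + w ^ 2 * C) * (A + w ^ 2 * B + w ^ 4 * C)
      * (A + w ^ 3 * B + w * C) * (A + w ^ 4 * B + w ^ 3 * C)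
    = A ^ 5 + B ^ 5 + C ^ 5 + 5 * A ^ 2 * B * C ^ 2 - 5 * A * B ^ 3 * C"
proof -
  define s t where "s = w + w ^ 4" and "t = w ^ 2 + w ^ 3"
  have st: "s + t = - 1" using w unfolding s_def t_def by Groebner_Basis.algebra
  have w5: "w ^ 5 = 1" using w by Groebner_Basis.algebra
  have prod: "s * t = - 1" using w unfolding s_def t_def by Groebner_Basis.algebra
  define U V W where "U = A ^ 2 + B ^ 2 + C ^ 2" and "V = B * (A + C)" and "W = A * C"
  have 1: "(A + w * B + w ^ 2 * C) * (A + w ^ 4 * B + w ^ 3 * C) = U + s * V + t * W"
    using w5 unfolding U_def V_def W_def s_def t_def by Groebner_Basis.algebra
  have 2: "(A + w ^ 2 * B + w ^ 4 * C) * (A + w ^ 3 * B + w * C) = U + t * V + s * W"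
    using w5 unfolding U_def V_def W_def s_def t_def by Groebner_Basis.algebra
  have 3: "(U + s * V + t * W) * (U + t * V + s * W)
    = U ^ 2 - U * V - U * W - V ^ 2 - W ^ 2 + 3 * V * W"
    using st prod by Groebner_Basis.algebra
  have "(A + B + C) * (A + w * B + w ^ 2 * C) * (A + w ^ 2 * B + w ^ 4 * C)
      * (A + w ^ 3 * B + w * C) * (A + w ^ 4 * B + w ^ 3 * C)
    = (A + B + C) * (((A + w * B + w ^ 2 * C) * (A + w ^ 4 * B + w ^ 3 * C)) *
       ((A + w ^ 2 * B + w ^ 4 * C) * (A + w ^ 3 * B + w * C)))"
    by (simp only: ac_simps)
  also have "\<dots> = (A + B + C) * (U ^ 2 - U * V - U * W - V ^ 2 - W ^ 2 + 3 * V * W)"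
    unfolding 1 2 3 ..
  also have "\<dots> = A ^ 5 + B ^ 5 + C ^ 5 + 5 * A ^ 2 * B * C ^ 2 - 5 * A * B ^ 3 * C"
    unfolding U_def V_def W_def by Groebner_Basis.algebra
  finally show ?thesis .
qed

lemma cyclotomic_sum_power:
  fixes w :: "'a :: idom"
  assumes w: "1 + w + w ^ 2 + w ^ 3 + w ^ 4 = 0" and "\<not> 5 dvd m"
  shows "1 + w ^ m + (w ^ m) ^ 2 + (w ^ m) ^ 3 + (w ^ m) ^ 4 = 0"
proof -
  have w5: "w ^ 5 = 1" using w by Groebner_Basis.algebra
  have "w ^ m = w ^ (5 * (m div 5) + m mod 5)" by simp
  also have "\<dots> = w ^ (m mod 5)" by (simp only: power_add power_mult w5) simp
  finally have *: "w ^ m = w ^ (m mod 5)" .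
  have "m mod 5 \<noteq> 0" "m mod 5 < 5" using assms(2) by (auto simp: dvd_eq_mod_eq_0)
  then have "m mod 5 = 1 \<or> m mod 5 = 2 \<or> m mod 5 = 3 \<or> m mod 5 = 4" by linarith
  then have "w ^ m = w \<or> w ^ m = w ^ 2 \<or> w ^ m = w ^ 3 \<or> w ^ m = w ^ 4"
    using * by (metis power_one_right)
  moreover have "1 + w ^ 2 + (w ^ 2) ^ 2 + (w ^ 2) ^ 3 + (w ^ 2) ^ 4 = 0"
    using w w5 by Groebner_Basis.algebra
  moreover have "1 + w ^ 3 + (w ^ 3) ^ 2 + (w ^ 3) ^ 3 + (w ^ 3) ^ 4 = 0"
    using w w5 by Groebner_Basis.algebra
  moreover have "1 + w ^ 4 + (w ^ 4) ^ 2 + (w ^ 4) ^ 3 + (w ^ 4) ^ 4 = 0"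
    using w w5 by Groebner_Basis.algebra
  ultimately show ?thesis using w by metis
qed

section \<open>The product of the conjugates of the Euler function\<close>

definition fps_twist :: "complex \<Rightarrow> complex fps \<Rightarrow> complex fps" where
  "fps_twist c f = f oo (fps_const c * fps_X)"

lemma fps_twist_nth: "fps_twist c f $ n = c ^ n * f $ n"
  by (simp add: fps_twist_def)

lemma fps_twist_add: "fps_twist c (f + g) = fps_twist c f + fps_twist c g"
  by (simp add: fps_twist_def fps_compose_add_distrib)

lemma fps_twist_qpoch:
  "fps_twist c (qpoch M) = (\<Prod>m=1..M. 1 - fps_const (c ^ m) * fps_X ^ m)"
proof -
  have "(fps_const c * fps_X :: complex fps) ^ m = fps_const (c ^ m) * fps_X ^ m" for m
    by (simp only: power_mult_distrib fps_const_power)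
  moreover have "(fps_const c * fps_X :: complex fps) $ 0 = 0" by simp
  ultimately show ?thesis
    by (simp only: fps_twist_def qpoch_def fps_compose_prod_distrib fps_compose_sub_distrib
        fps_compose_power[symmetric] fps_X_fps_compose_startby0 fps_compose_1)
qed

lemma fps_agree_twist: "fps_agree N f g \<Longrightarrow> fps_agree N (fps_twist c f) (fps_twist c g)"
  by (simp add: fps_agree_def fps_twist_nth)

lemma fps_twist_supp:
  assumes "fps_supp r f" "c ^ 5 = 1"
  shows "fps_twist c f = fps_const (c ^ r) * f"
proof (rule fps_ext)
  fix n
  have *: "c ^ k = c ^ (k mod 5)" for k
  proof -
    have "c ^ k = c ^ (5 * (k div 5) + k mod 5)" by simp
    also have "\<dots> = c ^ (k mod 5)" by (simp only: power_add power_mult assms(2)) simp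
    finally show ?thesis .
  qed
  show "fps_twist c f $ n = (fps_const (c ^ r) * f) $ n"
  proof (cases "f $ n = 0")
    case False
    then have "n mod 5 = r mod 5" using assms(1) by (auto simp: fps_supp_def)
    then have "c ^ n = c ^ r" using *[of n] *[of r] by simp
    then show ?thesis by (simp add: fps_twist_nth)
  qed (simp add: fps_twist_nth)
qed

lemma prod_multiples_of_5:
  "(\<Prod>m=1..5 * N. if 5 dvd m then g m else 1) = (\<Prod>j=1..N. g (5 * j))"
  for g :: "nat \<Rightarrow> 'a :: comm_monoid_mult"
proof -
  have "(\<Prod>m=1..5 * N. if 5 dvd m then g m else 1) = (\<Prod>m\<in>(\<lambda>j. 5 * j) ` {1..N}. g m)"
    by (intro prod.mono_neutral_cong_right) (auto elim!: dvdE)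
  also have "\<dots> = (\<Prod>j=1..N. g (5 * j))"
    by (subst prod.reindex) (auto simp: inj_on_def)
  finally show ?thesis .
qed

text \<open>For each m the conjugates of 1 - q^m multiply to (1 - q^m)^5 if 5 divides m and to 1 -
  q^(5 m) otherwise. The factors of E(q^25) supply the missing 1 - q^(5 m) at multiples of 5 and
  complete one copy of E(q^5); the fifth powers are five more.\<close>

lemma euler_norm:
  assumes w: "1 + w + w ^ 2 + w ^ 3 + w ^ 4 = 0"
  shows "fps_twist 1 euler_fps * fps_twist w euler_fps * fps_twist (w ^ 2) euler_fps
      * fps_twist (w ^ 3) euler_fps * fps_twist (w ^ 4) euler_fps * fps_dilate 25 euler_fps
    = fps_dilate 5 euler_fps ^ 6"
proof (rule fps_eqI_agree)
  fix N :: nat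
  define h :: "nat \<Rightarrow> complex fps"
    where "h m = (if 5 dvd m then (1 - fps_X ^ m) ^ 5 else 1 - fps_X ^ (5 * m))" for m
  have w5: "w ^ 5 = 1" using w by Groebner_Basis.algebra
  have h: "(1 - fps_const (1 ^ m) * fps_X ^ m) * (1 - fps_const (w ^ m) * fps_X ^ m)
      * (1 - fps_const ((w ^ 2) ^ m) * fps_X ^ m) * (1 - fps_const ((w ^ 3) ^ m) * fps_X ^ m)
      * (1 - fps_const ((w ^ 4) ^ m) * fps_X ^ m) = h m" for m
  proof -
    have comm: "(w ^ i) ^ m = (w ^ m) ^ i" for i
      by (simp only: power_mult[symmetric] mult.commute)
    show ?thesis
    proof (cases "5 dvd m")
      case True
      then obtain j where "m = 5 * j" ..
      then have "w ^ m = 1" by (simp only: power_mult w5) simp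
      then show ?thesis using True unfolding comm h_def by (simp add: eval_nat_numeral)
    next
      case False
      define v where "v = fps_const (w ^ m)"
      have "1 + v + v ^ 2 + v ^ 3 + v ^ 4 = fps_const (1 + w ^ m + (w ^ m) ^ 2 + (w ^ m) ^ 3 + (w ^ m) ^ 4)"
        by (simp add: v_def fps_eq_iff)
      then have v: "1 + v + v ^ 2 + v ^ 3 + v ^ 4 = 0"
        using cyclotomic_sum_power[OF w False] by simp
      show ?thesis
        using cyclotomic_norm[OF v, of 1 "- (fps_X ^ m)" 0] False unfolding comm h_def
        by (simp add: v_def fps_const_power power_mult[symmetric] mult.commute)
    qed
  qed
  \<comment> \<open>Truncating E(q^25) at \<open>N\<close> and the rest at \<open>5 * N\<close>
    makes the finite products match exactly.\<close>
  have "fps_agree N (fps_twist 1 euler_fps * fps_twist w euler_fps * fps_twist (w ^ 2) euler_fps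
      * fps_twist (w ^ 3) euler_fps * fps_twist (w ^ 4) euler_fps * fps_dilate 25 euler_fps)
    (fps_twist 1 (qpoch (5 * N)) * fps_twist w (qpoch (5 * N)) * fps_twist (w ^ 2) (qpoch (5 * N))
      * fps_twist (w ^ 3) (qpoch (5 * N)) * fps_twist (w ^ 4) (qpoch (5 * N)) * fps_dilate 25 (qpoch N))"
    by (intro fps_agree_mult fps_agree_twist fps_agree_dilate fps_agree_euler_ge) auto
  also have "fps_twist 1 (qpoch (5 * N)) * fps_twist w (qpoch (5 * N)) * fps_twist (w ^ 2) (qpoch (5 * N))
      * fps_twist (w ^ 3) (qpoch (5 * N)) * fps_twist (w ^ 4) (qpoch (5 * N)) = (\<Prod>m=1..5 * N. h m)"
    unfolding fps_twist_qpoch prod.distrib[symmetric] h ..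
  also have "fps_dilate 25 (qpoch N) = (\<Prod>m=1..5 * N. if 5 dvd m then 1 - fps_X ^ (5 * m) else 1 :: complex fps)"
    by (subst prod_multiples_of_5)
      (simp add: qpoch_def fps_dilate_prod fps_dilate_diff fps_dilate_power fps_dilate_X power_mult[symmetric])
  also have "(\<Prod>m=1..5 * N. h m) * \<dots>
    = (\<Prod>m=1..5 * N. (1 - fps_X ^ (5 * m)) * (if 5 dvd m then (1 - fps_X ^ m) ^ 5 else 1))"
    unfolding prod.distrib[symmetric] by (intro prod.cong) (auto simp: h_def)
  also have "\<dots> = fps_dilate 5 (qpoch (5 * N)) * fps_dilate 5 (qpoch N) ^ 5"
    unfolding prod.distrib prod_multiples_of_5
    by (simp add: qpoch_def fps_dilate_prod fps_dilate_diff fps_dilate_power fps_dilate_X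
        power_mult[symmetric] prod_power_distrib)
  also have "fps_agree N \<dots> (fps_dilate 5 euler_fps * fps_dilate 5 euler_fps ^ 5)"
    by (rule fps_agree_sym)
      (intro fps_agree_mult fps_agree_power fps_agree_dilate fps_agree_euler_ge; simp)
  finally show "fps_agree N (fps_twist 1 euler_fps * fps_twist w euler_fps * fps_twist (w ^ 2) euler_fps
      * fps_twist (w ^ 3) euler_fps * fps_twist (w ^ 4) euler_fps * fps_dilate 25 euler_fps)
    (fps_dilate 5 euler_fps ^ 6)"
    by (simp add: eval_nat_numeral)
qed

text \<open>The conjugates need a fifth root of unity, so the norm is computed over the complex
  numbers and pulled back along this injective ring homomorphism.\<close>

definition complex_fps :: "int fps \<Rightarrow> complex fps" where
  "complex_fps f = Abs_fps (\<lambda>n. of_int (f $ n))"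

lemma complex_fps_nth [simp]: "complex_fps f $ n = of_int (f $ n)"
  by (simp add: complex_fps_def)

lemma complex_fps_hom:
  "complex_fps (f + g) = complex_fps f + complex_fps g"
  "complex_fps (f - g) = complex_fps f - complex_fps g"
  "complex_fps (- f) = - complex_fps f"
  "complex_fps (f * g) = complex_fps f * complex_fps g"
  "complex_fps 1 = 1"
  "complex_fps fps_X = fps_X"
  by (simp_all add: fps_eq_iff fps_mult_nth fps_X_def)

lemma complex_fps_power: "complex_fps (f ^ n) = complex_fps f ^ n"
  by (induction n) (simp_all add: complex_fps_hom)

lemma complex_fps_prod: "complex_fps (prod f I) = (\<Prod>i\<in>I. complex_fps (f i))"
  by (induction I rule: infinite_finite_induct) (simp_all add: complex_fps_hom)

lemma complex_fps_numeral: "complex_fps (numeral n) = numeral n"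
  by (simp add: fps_eq_iff fps_numeral_nth)

lemma complex_fps_dilate: "l > 0 \<Longrightarrow> complex_fps (fps_dilate l f) = fps_dilate l (complex_fps f)"
  by (simp add: fps_eq_iff fps_nth_dilate)

lemma complex_fps_euler: "complex_fps euler_fps = euler_fps"
proof -
  have "complex_fps (qpoch n) = qpoch n" for n
    by (simp add: qpoch_def complex_fps_prod complex_fps_hom complex_fps_power)
  then have "of_int (qpoch n $ n) = (qpoch n $ n :: complex)" for n
    by (metis complex_fps_nth)
  then show ?thesis by (simp add: euler_fps_def fps_eq_iff)
qed

lemma complex_fps_inj: "complex_fps f = complex_fps g \<Longrightarrow> f = g"
  by (simp add: fps_eq_iff)

lemma fps_supp_complex: "fps_supp r f \<Longrightarrow> fps_supp r (complex_fps f)"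
  by (simp add: fps_supp_def)

lemma ex_fifth_root: "\<exists>w :: complex. 1 + w + w ^ 2 + w ^ 3 + w ^ 4 = 0"
proof -
  define w where "w = cis (2 * pi / 5)"
  have "w ^ 5 = 1" by (simp add: w_def DeMoivre)
  then have "(w - 1) * (1 + w + w ^ 2 + w ^ 3 + w ^ 4) = 0" by Groebner_Basis.algebra
  moreover have "w \<noteq> 1"
  proof
    assume "w = 1"
    then have "sin (2 * pi / 5) = 0" by (simp add: w_def complex_eq_iff)
    moreover have "sin (2 * pi / 5) > 0" by (rule sin_gt_zero) (use pi_gt_zero in auto)
    ultimately show False by simp
  qed
  ultimately show ?thesis by auto
qed

text \<open>Two evaluations of the product of conjugates are compared:
  \<open>cyclotomic_norm\<close> on the dissection, and \<open>euler_norm\<close>.\<close>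

lemma euler_norm_int:
  "(A_part ^ 5 + C_part ^ 5 - 11 * B_part ^ 5) * fps_dilate 25 euler_fps = fps_dilate 5 euler_fps ^ 6"
proof (rule complex_fps_inj)
  obtain w :: complex where w: "1 + w + w ^ 2 + w ^ 3 + w ^ 4 = 0" using ex_fifth_root by blast
  have w5: "w ^ 5 = 1" using w by Groebner_Basis.algebra
  define A where "A = complex_fps A_part"
  \<comment> \<open>The sign turns the dissection into the sum A + B + C that
    \<open>cyclotomic_norm\<close> expects.\<close>
  define B where "B = - complex_fps B_part"
  define C where "C = complex_fps C_part"
  define v where "v = fps_const w"
  have v5: "v ^ 5 = 1" using w5 by (simp add: v_def fps_const_power)
  have vsum: "1 + v + v ^ 2 + v ^ 3 + v ^ 4 = 0"
  proof -
    have "1 + v + v ^ 2 + v ^ 3 + v ^ 4 = fps_const (1 + w + w ^ 2 + w ^ 3 + w ^ 4)"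
      by (simp add: v_def fps_eq_iff)
    then show ?thesis using w by simp
  qed
  have AC: "A * C = - (B ^ 2)"
    using arg_cong[OF A_mult_C, of complex_fps]
    by (simp add: A_def B_def C_def complex_fps_hom complex_fps_power)
  have E: "euler_fps = A + B + C"
    using arg_cong[OF euler_dissection, of complex_fps]
    by (simp add: A_def B_def C_def complex_fps_hom complex_fps_euler)
  have B_supp: "fps_supp 1 B"
    using fps_supp_complex[OF fps_supp_B_part] by (simp add: B_def fps_supp_def)
  have tw: "fps_twist (w ^ i) euler_fps = A + v ^ i * B + v ^ (2 * i) * C" for i
  proof -
    have "(w ^ i) ^ 5 = 1" using w5 by (metis power_mult mult.commute power_one)
    then show ?thesis
      unfolding E fps_twist_add
      using fps_twist_supp[OF fps_supp_complex[OF fps_supp_A_part]] fps_twist_supp[OF B_supp]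
        fps_twist_supp[OF fps_supp_complex[OF fps_supp_C_part]]
      by (simp add: A_def C_def v_def fps_const_power power_mult[symmetric] mult.commute)
  qed
  have tws: "fps_twist 1 euler_fps = A + B + C" "fps_twist w euler_fps = A + v * B + v ^ 2 * C"
    "fps_twist (w ^ 2) euler_fps = A + v ^ 2 * B + v ^ 4 * C"
    "fps_twist (w ^ 3) euler_fps = A + v ^ 3 * B + v * C"
    "fps_twist (w ^ 4) euler_fps = A + v ^ 4 * B + v ^ 3 * C"
  proof -
    have "v ^ 6 = v" "v ^ 8 = v ^ 3" using v5 by Groebner_Basis.algebra+
    then show "fps_twist 1 euler_fps = A + B + C" "fps_twist w euler_fps = A + v * B + v ^ 2 * C"
      "fps_twist (w ^ 2) euler_fps = A + v ^ 2 * B + v ^ 4 * C"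
      "fps_twist (w ^ 3) euler_fps = A + v ^ 3 * B + v * C"
      "fps_twist (w ^ 4) euler_fps = A + v ^ 4 * B + v ^ 3 * C"
      using tw[of 0] tw[of 1] tw[of 2] tw[of 3] tw[of 4] by simp_all
  qed
  \<comment> \<open>By \<open>AC\<close> each of the two mixed terms becomes
    \<open>5 * B ^ 5\<close>, hence the 11.\<close>
  have "A ^ 5 + B ^ 5 + C ^ 5 + 5 * A ^ 2 * B * C ^ 2 - 5 * A * B ^ 3 * C = A ^ 5 + C ^ 5 + 11 * B ^ 5"
    using AC by Groebner_Basis.algebra
  then have "(A ^ 5 + C ^ 5 + 11 * B ^ 5) * fps_dilate 25 euler_fps = fps_dilate 5 euler_fps ^ 6"
    using euler_norm[OF w] unfolding tws cyclotomic_norm[OF vsum] by (simp only:)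
  then show "complex_fps ((A_part ^ 5 + C_part ^ 5 - 11 * B_part ^ 5) * fps_dilate 25 euler_fps)
    = complex_fps (fps_dilate 5 euler_fps ^ 6)"
    by (simp add: A_def B_def C_def complex_fps_hom complex_fps_power complex_fps_dilate
        complex_fps_euler complex_fps_numeral)
qed

text \<open>A + C = E + b and A C = - b^2 determine the symmetric expression A^5 + C^5 as a
  polynomial in E and b; its b^5 term cancels against 11 b^5.\<close>

lemma euler_quintic:
  defines "E \<equiv> euler_fps :: int fps" and "b \<equiv> B_part"
  shows "(E ^ 5 + 5 * E ^ 4 * b + 15 * E ^ 3 * b ^ 2 + 25 * E ^ 2 * b ^ 3 + 25 * E * b ^ 4)
    * fps_dilate 25 euler_fps = fps_dilate 5 euler_fps ^ 6"
proof -
  have "E = A_part - b + C_part" "A_part * C_part = - (b ^ 2)"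
    unfolding E_def b_def by (rule euler_dissection, rule A_mult_C)
  then have "E ^ 5 + 5 * E ^ 4 * b + 15 * E ^ 3 * b ^ 2 + 25 * E ^ 2 * b ^ 3 + 25 * E * b ^ 4
    = A_part ^ 5 + C_part ^ 5 - 11 * b ^ 5"
    by Groebner_Basis.algebra
  then show ?thesis using euler_norm_int unfolding b_def by simp
qed

section \<open>The section operator and the 5-adic lattice\<close>

lemma fps_section_const_mult:
  "fps_section l (fps_const c * f) = fps_const c * fps_section l (f :: 'a :: comm_ring_1 fps)"
  by (rule fps_ext) simp

lemma fps_section_numeral_mult:
  "fps_section l (numeral c * f) = numeral c * fps_section l (f :: 'a :: comm_ring_1 fps)"
  by (simp only: numeral_fps_const fps_section_const_mult)

lemma fps_section_uminus: "fps_section l (- f) = - fps_section l (f :: 'a :: comm_ring_1 fps)"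
  by (rule fps_ext) simp

lemmas fps_section_linear = fps_section_add fps_section_diff fps_section_uminus fps_section_numeral_mult

lemma fps_section_supp: "fps_supp r f \<Longrightarrow> \<not> 5 dvd r \<Longrightarrow> fps_section 5 f = 0"
  by (rule fps_ext) (auto simp: fps_supp_def dvd_eq_mod_eq_0)

section \<open>The series y and t\<close>

abbreviation "E1 \<equiv> euler_fps :: int fps"
abbreviation "E5 \<equiv> fps_dilate 5 euler_fps :: int fps"
abbreviation "E25 \<equiv> fps_dilate 25 euler_fps :: int fps"
abbreviation "P1 \<equiv> partition_fps :: int fps"
abbreviation "P5 \<equiv> fps_dilate 5 partition_fps :: int fps"
abbreviation "P25 \<equiv> fps_dilate 25 partition_fps :: int fps"

definition y_fps :: "int fps" where "y_fps = B_part * P1"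
definition t_fps :: "int fps" where "t_fps = fps_X * E5 ^ 6 * P1 ^ 6"

lemma euler_dilate_partition: "l > 0 \<Longrightarrow> fps_dilate l E1 * fps_dilate l P1 = 1"
  by (simp add: fps_dilate_mult[symmetric] euler_partition_fps)

lemma dilate_5_t: "fps_dilate 5 t_fps = fps_X ^ 5 * E25 ^ 6 * P5 ^ 6"
  by (simp add: t_fps_def fps_dilate_mult fps_dilate_power fps_dilate_X fps_dilate_dilate)

lemma B_part_power_5: "B_part ^ 5 = fps_dilate 5 (fps_X * E5 ^ 5)"
  by (simp add: B_part_def fps_dilate_mult fps_dilate_power fps_dilate_X fps_dilate_dilate power_mult_distrib)

lemma dilate_5_t_eq: "fps_dilate 5 t_fps = E25 * P5 ^ 6 * B_part ^ 5"
proof -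
  have "E25 ^ 6 = E25 * E25 ^ 5" using power_Suc[of E25 5] by simp
  then show ?thesis by (simp add: dilate_5_t B_part_def power_mult_distrib)
qed

definition y_quartic :: "int fps" where
  "y_quartic = 1 + 5 * y_fps + 15 * y_fps ^ 2 + 25 * y_fps ^ 3 + 25 * y_fps ^ 4"

text \<open>This is \<open>euler_quintic\<close> divided by \<open>E1 ^ 5\<close> and
  \<open>E25\<close>.\<close>

lemma y_quartic_eq: "y_quartic = E5 ^ 6 * P25 * P1 ^ 5"
proof -
  define Z where "Z = E1 ^ 5 + 5 * E1 ^ 4 * B_part + 15 * E1 ^ 3 * B_part ^ 2
    + 25 * E1 ^ 2 * B_part ^ 3 + 25 * E1 * B_part ^ 4"
  have "E1 * P1 = 1" by (rule euler_partition_fps)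
  then have "y_quartic = Z * P1 ^ 5"
    unfolding y_quartic_def y_fps_def Z_def by Groebner_Basis.algebra
  moreover have "Z = Z * E25 * P25"
    using euler_dilate_partition[of 25] by (simp add: mult.assoc)
  ultimately show ?thesis using euler_quintic by (simp add: Z_def)
qed

lemma t_eq_y: "t_fps = y_fps * y_quartic"
proof -
  have "y_fps * y_quartic = (E25 * P25) * (fps_X * E5 ^ 6 * P1 ^ 6)"
    unfolding y_quartic_eq by (simp add: y_fps_def B_part_def eval_nat_numeral)
  then show ?thesis using euler_dilate_partition[of 25] by (simp add: t_fps_def)
qed

text \<open>The factor \<open>E25 * P5 ^ 6\<close> is a series in q^5, and
  \<open>y_fps * E1 = B_part\<close> turns the rest into monomials in \<open>B_part\<close> and
  \<open>E1\<close>, whose sections follow from the dissection.\<close>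

lemma y_via_dilate: "y_fps = E25 * P5 ^ 6 * y_fps * y_quartic * E1 ^ 5"
proof -
  have "E25 * P5 ^ 6 * y_fps * y_quartic * E1 ^ 5
    = (E25 * P25) * (E5 * P5) ^ 6 * (E1 * P1) ^ 5 * y_fps"
    unfolding y_quartic_eq power_mult_distrib by (simp only: ac_simps)
  then show ?thesis by (simp add: euler_dilate_partition euler_partition_fps)
qed

lemma y_power_5: "y_fps ^ 5 = fps_dilate 5 t_fps * y_quartic"
proof -
  have "fps_dilate 5 t_fps * y_quartic = (E25 * P25) * (E5 * P5) ^ 6 * y_fps ^ 5"
    unfolding y_quartic_eq dilate_5_t_eq y_fps_def power_mult_distrib by (simp only: ac_simps)
  then show ?thesis by (simp add: euler_dilate_partition)
qed

text \<open>Replacing A C by - b^2 leaves only monomials b^i A^j and b^i C^j with i + j = 5. Their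
  exponents lie in the classes i and i + 2 j modulo 5, so the section kills all of them except
  b^5.\<close>

lemma section_B_E:
  shows "fps_section 5 (B_part ^ 4 * E1) = - (fps_X * E5 ^ 5)"
    and "fps_section 5 (B_part ^ 3 * E1 ^ 2) = - (fps_X * E5 ^ 5)"
    and "fps_section 5 (B_part ^ 2 * E1 ^ 3) = 5 * (fps_X * E5 ^ 5)"
    and "fps_section 5 (B_part * E1 ^ 4) = - 5 * (fps_X * E5 ^ 5)"
proof -
  define A b C where "A = A_part" and "b = B_part" and "C = C_part"
  have E: "E1 = A - b + C" and AC: "A * C = - (b ^ 2)"
    unfolding A_def b_def C_def by (rule euler_dissection, rule A_mult_C)
  have b5: "fps_section 5 (b ^ 5) = fps_X * E5 ^ 5"
    by (simp add: b_def B_part_power_5 fps_section_dilate)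
  have A: "fps_section 5 (b ^ i * A ^ j) = 0" if "\<not> 5 dvd i" for i j
    using fps_supp_mult[OF fps_supp_power[OF fps_supp_B_part] fps_supp_power[OF fps_supp_A_part], of i j]
      that unfolding A_def b_def by (intro fps_section_supp) auto
  have C: "fps_section 5 (b ^ i * C ^ j) = 0" if "\<not> 5 dvd i + 2 * j" for i j
    using fps_supp_mult[OF fps_supp_power[OF fps_supp_B_part] fps_supp_power[OF fps_supp_C_part], of i j]
      that unfolding C_def b_def by (intro fps_section_supp) (auto simp: mult.commute)
  have "b ^ 4 * E1 = b ^ 4 * A ^ 1 + b ^ 4 * C ^ 1 - b ^ 5"
    using E AC by Groebner_Basis.algebra
  then show "fps_section 5 (B_part ^ 4 * E1) = - (fps_X * E5 ^ 5)"
    unfolding b_def[symmetric] using A[of 4 1] C[of 4 1] by (simp add: fps_section_linear b5)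
  have "b ^ 3 * E1 ^ 2 = b ^ 3 * A ^ 2 + b ^ 3 * C ^ 2 - 2 * (b ^ 4 * A ^ 1) - 2 * (b ^ 4 * C ^ 1) - b ^ 5"
    using E AC by Groebner_Basis.algebra
  then show "fps_section 5 (B_part ^ 3 * E1 ^ 2) = - (fps_X * E5 ^ 5)"
    unfolding b_def[symmetric] using A[of 4 1] C[of 4 1] A[of 1 4] C[of 1 4]
    by (simp add: fps_section_linear A C b5)
  have "b ^ 2 * E1 ^ 3 = b ^ 2 * A ^ 3 + b ^ 2 * C ^ 3 - 3 * (b ^ 3 * A ^ 2) - 3 * (b ^ 3 * C ^ 2) + 5 * b ^ 5"
    using E AC by Groebner_Basis.algebra
  then show "fps_section 5 (B_part ^ 2 * E1 ^ 3) = 5 * (fps_X * E5 ^ 5)"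
    unfolding b_def[symmetric] using A[of 4 1] C[of 4 1] A[of 1 4] C[of 1 4]
    by (simp add: fps_section_linear A C b5)
  have "b * E1 ^ 4 = b ^ 1 * A ^ 4 + b ^ 1 * C ^ 4 - 4 * (b ^ 2 * A ^ 3) + 2 * (b ^ 3 * A ^ 2) + 8 * (b ^ 4 * A ^ 1)
     - 4 * (b ^ 2 * C ^ 3) + 2 * (b ^ 3 * C ^ 2) + 8 * (b ^ 4 * C ^ 1) - 5 * b ^ 5"
    using E AC by Groebner_Basis.algebra
  then show "fps_section 5 (B_part * E1 ^ 4) = - 5 * (fps_X * E5 ^ 5)"
    unfolding b_def[symmetric] using A[of 4 1] C[of 4 1] A[of 1 4] C[of 1 4]
    by (simp add: fps_section_linear A C b5)
qed

section \<open>The action of U on powers of y\<close>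

definition section_y :: "nat \<Rightarrow> int fps" where
  "section_y k = fps_section 5 (y_fps ^ k)"

lemma section_y_add_5:
  "section_y (k + 5) = t_fps * (section_y k + 5 * section_y (k + 1) + 15 * section_y (k + 2)
    + 25 * section_y (k + 3) + 25 * section_y (k + 4))"
proof -
  have "y_fps ^ (k + 5) = fps_dilate 5 t_fps * (y_fps ^ k + 5 * y_fps ^ (k + 1) + 15 * y_fps ^ (k + 2)
    + 25 * y_fps ^ (k + 3) + 25 * y_fps ^ (k + 4))"
    unfolding power_add y_power_5 y_quartic_def by (simp add: algebra_simps)
  then show ?thesis
    by (simp only: section_y_def fps_section_dilate_mult fps_section_linear zero_less_numeral)
qed

lemma section_y_0: "section_y 0 = 1"
  by (rule fps_ext) (simp add: section_y_def)

text \<open>Multiplying \<open>y_via_dilate\<close> by powers of y and using y E = b writes y^k as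
  multiples of D b^i E^(5 - i), with D a series in q^5, plus terms t(q^5) y^j with j < k, whose
  sections are already known.\<close>

lemma section_y_small:
  shows "section_y 1 = 5 * t_fps"
    and "section_y 2 = 10 * t_fps + 125 * t_fps ^ 2"
    and "section_y 3 = 9 * t_fps + 375 * t_fps ^ 2 + 3125 * t_fps ^ 3"
    and "section_y 4 = 4 * t_fps + 550 * t_fps ^ 2 + 12500 * t_fps ^ 3 + 78125 * t_fps ^ 4"
proof -
  define b y where "b = B_part" and "y = y_fps"
  have EP: "E1 * P1 = 1" by (rule euler_partition_fps)
  define D where "D = fps_dilate 5 (E5 * P1 ^ 6)"
  have D: "D = E25 * P5 ^ 6"
    by (simp add: D_def fps_dilate_mult fps_dilate_power fps_dilate_dilate)
  have yE: "y * E1 = b" using EP by (simp add: y_def y_fps_def b_def mult.assoc mult.commute)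
  have y: "y = D * y * (1 + 5 * y + 15 * y ^ 2 + 25 * y ^ 3 + 25 * y ^ 4) * E1 ^ 5"
    using y_via_dilate unfolding D y_def y_quartic_def by simp
  have Db5: "D * b ^ 5 = fps_dilate 5 t_fps" by (simp add: D b_def dilate_5_t_eq)
  have t: "E5 * P1 ^ 6 * (fps_X * E5 ^ 5) = t_fps"
    by (simp add: t_fps_def eval_nat_numeral)
  have U: "fps_section 5 (D * f) = E5 * P1 ^ 6 * fps_section 5 f" for f
    unfolding D_def by (rule fps_section_dilate_mult) simp
  have Ut: "fps_section 5 (fps_dilate 5 t_fps * f) = t_fps * fps_section 5 f" for f
    by (rule fps_section_dilate_mult) simp
  have Ut1: "fps_section 5 (fps_dilate 5 t_fps) = t_fps"
    by (rule fps_section_dilate) simp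
  have U1: "fps_section 5 (D * (b * E1 ^ 4)) = - 5 * t_fps"
    and U2: "fps_section 5 (D * (b ^ 2 * E1 ^ 3)) = 5 * t_fps"
    and U3: "fps_section 5 (D * (b ^ 3 * E1 ^ 2)) = - t_fps"
    and U4: "fps_section 5 (D * (b ^ 4 * E1)) = - t_fps"
    unfolding U b_def section_B_E t[symmetric] by (simp_all add: algebra_simps)
  note U_simps = U1 U2 U3 U4 Ut Ut1 fps_section_linear
  have "y = D * (b * E1 ^ 4) + 5 * (D * (b ^ 2 * E1 ^ 3)) + 15 * (D * (b ^ 3 * E1 ^ 2))
    + 25 * (D * (b ^ 4 * E1)) + 25 * fps_dilate 5 t_fps"
    using y yE Db5 by Groebner_Basis.algebra
  from arg_cong[OF this, of "fps_section 5"]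
  show 1: "section_y 1 = 5 * t_fps"
    unfolding section_y_def y_def power_one_right by (simp only: U_simps) simp
  have "y ^ 2 = D * (b ^ 2 * E1 ^ 3) + 5 * (D * (b ^ 3 * E1 ^ 2)) + 15 * (D * (b ^ 4 * E1))
    + 25 * fps_dilate 5 t_fps + 25 * (fps_dilate 5 t_fps * y)"
    using y yE Db5 by Groebner_Basis.algebra
  from arg_cong[OF this, of "fps_section 5"]
  show 2: "section_y 2 = 10 * t_fps + 125 * t_fps ^ 2"
    using 1 unfolding section_y_def y_def power_one_right
    by (simp only: U_simps) (simp add: algebra_simps power2_eq_square)
  have "y ^ 3 = D * (b ^ 3 * E1 ^ 2) + 5 * (D * (b ^ 4 * E1)) + 15 * fps_dilate 5 t_fps
    + 25 * (fps_dilate 5 t_fps * y) + 25 * (fps_dilate 5 t_fps * y ^ 2)"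
    using y yE Db5 by Groebner_Basis.algebra
  from arg_cong[OF this, of "fps_section 5"]
  show 3: "section_y 3 = 9 * t_fps + 375 * t_fps ^ 2 + 3125 * t_fps ^ 3"
    using 1 2 unfolding section_y_def y_def power_one_right
    by (simp only: U_simps) (simp add: algebra_simps power2_eq_square power3_eq_cube)
  have "y ^ 4 = D * (b ^ 4 * E1) + 5 * fps_dilate 5 t_fps
    + 15 * (fps_dilate 5 t_fps * y) + 25 * (fps_dilate 5 t_fps * y ^ 2) + 25 * (fps_dilate 5 t_fps * y ^ 3)"
    using y yE Db5 by Groebner_Basis.algebra
  from arg_cong[OF this, of "fps_section 5"]
  show "section_y 4 = 4 * t_fps + 550 * t_fps ^ 2 + 12500 * t_fps ^ 3 + 78125 * t_fps ^ 4"
    using 1 2 3 unfolding section_y_def y_def power_one_right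
    by (simp only: U_simps) (simp add: algebra_simps eval_nat_numeral)
qed

text \<open>The bound on the exponent of 5 is the one that the recurrence for \<open>U (y ^ k)\<close> preserves. The
  subtractions are truncated, so the exponent is always at least \<open>a\<close>.\<close>

inductive t_lattice :: "nat \<Rightarrow> nat \<Rightarrow> int fps \<Rightarrow> bool" for a k where
  zero: "t_lattice a k 0"
| step: "t_lattice a k x \<Longrightarrow> j \<ge> 1 \<Longrightarrow> a + (5 * j - k - 1) div 2 \<le> e \<Longrightarrow>
    t_lattice a k (x + of_int c * 5 ^ e * t_fps ^ j)"

lemma t_lattice_gen:
  "j \<ge> 1 \<Longrightarrow> a + (5 * j - k - 1) div 2 \<le> e \<Longrightarrow> t_lattice a k (of_int c * 5 ^ e * t_fps ^ j)"
  using t_lattice.step[OF t_lattice.zero] by simp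

lemma t_lattice_add:
  assumes "t_lattice a k x" "t_lattice a k x'"
  shows "t_lattice a k (x + x')"
  using assms(2)
proof induction
  case zero
  show ?case using assms(1) by simp
next
  case (step z j e c)
  then show ?case using t_lattice.step[of a k "x + z" j e c] by (simp add: add.assoc)
qed

text \<open>The \<open>d\<close> extra factors of 5 pay for a larger offset or a smaller index
  \<open>k\<close>.\<close>

lemma t_lattice_scale:
  assumes "t_lattice a k x"
    and "\<And>j. j \<ge> 1 \<Longrightarrow> a' + (5 * j - k' - 1) div 2 \<le> d + (a + (5 * j - k - 1) div 2)"
  shows "t_lattice a' k' (of_int c * 5 ^ d * x)"
  using assms(1)
proof induction
  case zero
  show ?case by (simp add: t_lattice.zero)
next
  case (step z j e c')
  have "a' + (5 * j - k' - 1) div 2 \<le> d + e" using assms(2)[of j] step.hyps by linarith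
  with step have "t_lattice a' k' (of_int c * 5 ^ d * z + of_int (c * c') * 5 ^ (d + e) * t_fps ^ j)"
    by (intro t_lattice.step) auto
  then show ?case by (simp add: algebra_simps power_add)
qed

text \<open>Raising j by 1 and k by 5 leaves 5 j - k unchanged.\<close>

lemma t_lattice_mult_t: "t_lattice a k x \<Longrightarrow> t_lattice a (k + 5) (t_fps * x)"
proof (induction rule: t_lattice.induct)
  case zero
  show ?case by (simp add: t_lattice.zero)
next
  case (step z j e c)
  have "5 * (j + 1) - (k + 5) - 1 = 5 * j - k - 1" by simp
  with step have "t_lattice a (k + 5) (t_fps * z + of_int c * 5 ^ e * t_fps ^ (j + 1))"
    by (intro t_lattice.step) auto
  then show ?case by (simp add: algebra_simps)
qed

text \<open>Lowering the index by 1, 2, 3, 4 costs at most 1, 1, 2, 2 in the exponent, exactly the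
  powers of 5 in the coefficients 5, 15, 25, 25.\<close>

lemma t_lattice_quartic:
  assumes "t_lattice a k x0" "t_lattice a (k + 1) x1" "t_lattice a (k + 2) x2"
    "t_lattice a (k + 3) x3" "t_lattice a (k + 4) x4"
  shows "t_lattice a k (x0 + 5 * x1 + 15 * x2 + 25 * x3 + 25 * x4)"
proof -
  have "t_lattice a k (of_int 1 * 5 ^ 1 * x1)" "t_lattice a k (of_int 3 * 5 ^ 1 * x2)"
    "t_lattice a k (of_int 1 * 5 ^ 2 * x3)" "t_lattice a k (of_int 1 * 5 ^ 2 * x4)"
    by (rule t_lattice_scale[OF assms(2)], linarith, rule t_lattice_scale[OF assms(3)], linarith,
        rule t_lattice_scale[OF assms(4)], linarith, rule t_lattice_scale[OF assms(5)], linarith)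
  then show ?thesis
    using assms(1) by (auto intro!: t_lattice_add)
qed

lemma t_lattice_section_y:
  assumes "k \<ge> 1"
  shows "t_lattice 0 k (section_y k)"
  using assms
proof (induction k rule: less_induct)
  case (less k)
  have t1: "t_lattice 0 k (of_int c * t_fps)" if "5 ^ ((5 - k - 1) div 2) dvd c" for c k
  proof -
    from that obtain d where "c = 5 ^ ((5 - k - 1) div 2) * d" ..
    then show ?thesis using t_lattice_gen[of 1 0 k "(5 - k - 1) div 2" d] by (simp add: mult.commute)
  qed
  have tn: "t_lattice 0 k (of_int c * t_fps ^ j)" if "5 ^ ((5 * j - k - 1) div 2) dvd c" "j \<ge> 1" for c k j
  proof -
    from that(1) obtain d where "c = 5 ^ ((5 * j - k - 1) div 2) * d" ..
    then show ?thesis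
      using t_lattice_gen[of j 0 k "(5 * j - k - 1) div 2" d] that by (simp add: mult.commute)
  qed
  have base: "t_lattice 0 1 (section_y 1)" "t_lattice 0 2 (section_y 2)"
    "t_lattice 0 3 (section_y 3)" "t_lattice 0 4 (section_y 4)"
    unfolding section_y_small
    using t1[where k = 1 and c = 5] t1[where k = 2 and c = 10] tn[where k = 2 and c = 125 and j = 2]
      t1[where k = 3 and c = 9] tn[where k = 3 and c = 375 and j = 2] tn[where k = 3 and c = 3125 and j = 3]
      t1[where k = 4 and c = 4] tn[where k = 4 and c = 550 and j = 2] tn[where k = 4 and c = 12500 and j = 3]
      tn[where k = 4 and c = 78125 and j = 4]
    by (auto intro!: t_lattice_add)
  have "k = 1 \<or> k = 2 \<or> k = 3 \<or> k = 4 \<or> k = 5 \<or> k = (k - 5) + 5 \<and> k - 5 \<ge> 1"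
    using less.prems by linarith
  then consider "k = 1" | "k = 2" | "k = 3" | "k = 4" | "k = 5" | i where "k = i + 5" "i \<ge> 1"
    by blast
  then show ?case
  proof cases
    \<comment> \<open>The recurrence reaches back to \<open>section_y 0 = 1\<close>, which is
      outside the lattice for lack of constant generators; its contribution \<open>t_fps\<close> is
      treated separately.\<close>
    case 5
    have "t_lattice 0 (0 + 5) (t_fps * (0 + 5 * section_y 1 + 15 * section_y 2 + 25 * section_y 3 + 25 * section_y 4))"
      by (intro t_lattice_mult_t t_lattice_quartic t_lattice.zero) (use base in \<open>simp_all only: add_0\<close>)
    then have "t_lattice 0 5 (t_fps * (0 + 5 * section_y 1 + 15 * section_y 2 + 25 * section_y 3 + 25 * section_y 4))"
      by simp
    moreover have "t_lattice 0 5 (of_int 1 * t_fps)" by (rule t1) simp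
    ultimately have "t_lattice 0 5 (of_int 1 * t_fps +
      t_fps * (0 + 5 * section_y 1 + 15 * section_y 2 + 25 * section_y 3 + 25 * section_y 4))"
      by (intro t_lattice_add)
    then show ?thesis
      using section_y_add_5[of 0] 5
      by (simp only: section_y_0 add_0 of_int_1 mult_1 distrib_left mult_1_right add.assoc)
  next
    case (6 i)
    show ?thesis
      unfolding 6(1) section_y_add_5
      by (intro t_lattice_mult_t t_lattice_quartic less.IH) (use 6 in simp_all)
  qed (use base in simp_all)
qed

text \<open>Trading one factor t for y times the quartic raises the power of y by 1 to 5, and
  \<open>t_lattice_quartic\<close> absorbs the sum. Thus a factor t counts in the index like a
  factor y.\<close>

lemma t_lattice_section_y_t:
  assumes "r + i \<ge> 1"
  shows "t_lattice 0 (r + i) (fps_section 5 (y_fps ^ r * t_fps ^ i))"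
  using assms
proof (induction i arbitrary: r)
  case 0
  then show ?case using t_lattice_section_y[of r] by (simp add: section_y_def)
next
  case (Suc i)
  define f where "f s = y_fps ^ s * t_fps ^ i" for s
  have "y_fps ^ r * t_fps ^ Suc i = f (r + 1) + 5 * f (r + 2) + 15 * f (r + 3) + 25 * f (r + 4) + 25 * f (r + 5)"
    by (simp add: f_def t_eq_y y_quartic_def algebra_simps eval_nat_numeral)
  then have "fps_section 5 (y_fps ^ r * t_fps ^ Suc i) =
    fps_section 5 (f (r + 1)) + 5 * fps_section 5 (f (r + 2)) + 15 * fps_section 5 (f (r + 3))
    + 25 * fps_section 5 (f (r + 4)) + 25 * fps_section 5 (f (r + 5))"
    by (simp only: fps_section_linear)
  also have "t_lattice 0 (r + Suc i) \<dots>"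
    using Suc.IH[of "r + 1"] Suc.IH[of "r + 2"] Suc.IH[of "r + 3"] Suc.IH[of "r + 4"] Suc.IH[of "r + 5"]
    unfolding f_def by (intro t_lattice_quartic) (simp_all add: add_ac eval_nat_numeral)
  finally show ?case .
qed

text \<open>\<open>t_lattice_section_y_t\<close> is applied to each generator
  \<open>t_fps ^ i\<close>; the second premise is the comparison of exponents that results.\<close>

lemma t_lattice_section:
  assumes "t_lattice a 4 x"
    and "\<And>i j. i \<ge> 1 \<Longrightarrow> j \<ge> 1 \<Longrightarrow>
      a' + (5 * j - 5) div 2 \<le> a + (5 * i - 5) div 2 + (5 * j - (r + i) - 1) div 2"
  shows "t_lattice a' 4 (fps_section 5 (y_fps ^ r * x))"
  using assms(1)
proof induction
  case zero
  show ?case by (simp add: t_lattice.zero)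
next
  case (step x i e c)
  have "t_lattice a' 4 (of_int c * 5 ^ e * fps_section 5 (y_fps ^ r * t_fps ^ i))"
  proof (rule t_lattice_scale[OF t_lattice_section_y_t])
    fix j :: nat assume "j \<ge> 1"
    with assms(2)[of i j] step.hyps
    show "a' + (5 * j - 4 - 1) div 2 \<le> e + (0 + (5 * j - (r + i) - 1) div 2)" by simp
  qed (use step.hyps in simp)
  moreover have "of_int c * 5 ^ e = (fps_const (c * 5 ^ e) :: int fps)"
    by (simp add: fps_of_int[symmetric] numeral_fps_const fps_const_power)
  ultimately have "t_lattice a' 4 (fps_section 5 (y_fps ^ r * x) +
      fps_section 5 (y_fps ^ r * (of_int c * 5 ^ e * t_fps ^ i)))"
    using step.IH by (simp only: mult.left_commute[of "y_fps ^ r"] fps_section_const_mult t_lattice_add)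
  then show ?case by (simp add: distrib_left fps_section_add)
qed

text \<open>With i = m + 1, the generator brings at least 2 m factors of 5, while the larger index
  costs only about m / 2. The margin is decided at m = 0: an index \<open>r + i\<close> of at most 2
  leaves one factor 5 to spare, an index of 3 in general none.\<close>

lemma lattice_exponent_bound:
  fixes i j r :: nat
  assumes "i \<ge> 1" "j \<ge> 1"
  shows "r \<le> 1 \<Longrightarrow> 1 + (5 * j - 5) div 2 \<le> (5 * i - 5) div 2 + (5 * j - (r + i) - 1) div 2"
    and "r \<le> 2 \<Longrightarrow> (5 * j - 5) div 2 \<le> (5 * i - 5) div 2 + (5 * j - (r + i) - 1) div 2"
proof -
  obtain m where i: "i = m + 1" using assms(1) by (metis add.commute le_Suc_ex)
  define z where "z = 5 * j - (r + i) - 1"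
  have m: "2 * m \<le> (5 * i - 5) div 2" by (simp add: i)
  show "1 + (5 * j - 5) div 2 \<le> (5 * i - 5) div 2 + (5 * j - (r + i) - 1) div 2" if "r \<le> 1"
  proof (cases "m = 0")
    case True
    then have "(5 * j - 5 + 2 * 1) div 2 \<le> z div 2"
      using assms(2) that by (intro div_le_mono) (simp add: z_def i)
    then show ?thesis by (simp add: z_def)
  next
    case False
    then have "(5 * j - 5) div 2 \<le> (z + 2 * (m - 1)) div 2"
      using that by (intro div_le_mono) (simp add: z_def i)
    also have "\<dots> = z div 2 + (m - 1)" by simp
    finally have "1 + (5 * j - 5) div 2 \<le> z div 2 + m" using False by simp
    also have "\<dots> \<le> (5 * i - 5) div 2 + z div 2" using m by simp
    finally show ?thesis by (simp only: z_def)
  qed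
  show "(5 * j - 5) div 2 \<le> (5 * i - 5) div 2 + (5 * j - (r + i) - 1) div 2" if "r \<le> 2"
  proof -
    have "(5 * j - 5) div 2 \<le> (z + 2 * m) div 2"
      using that by (intro div_le_mono) (simp add: z_def i)
    then have "(5 * j - 5) div 2 \<le> z div 2 + m" by simp
    then show ?thesis using m by (simp add: z_def)
  qed
qed

lemma t_lattice_section_0: "t_lattice a 4 x \<Longrightarrow> t_lattice (a + 1) 4 (fps_section 5 x)"
  using t_lattice_section[of a x "a + 1" 0] lattice_exponent_bound(1)[of _ _ 0] by simp

lemma t_lattice_section_1: "t_lattice a 4 x \<Longrightarrow> t_lattice (a + 1) 4 (fps_section 5 (y_fps * x))"
  using t_lattice_section[of a x "a + 1" 1] lattice_exponent_bound(1)[of _ _ 1] by simp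

lemma t_lattice_section_2: "t_lattice a 4 x \<Longrightarrow> t_lattice a 4 (fps_section 5 (y_fps ^ 2 * x))"
  using t_lattice_section[of a x a 2] lattice_exponent_bound(2)[of _ _ 2] by simp

section \<open>Arithmetic progressions\<close>

lemma t_lattice_dvd:
  assumes "t_lattice a k x"
  obtains z where "x = fps_const (5 ^ a) * z"
proof -
  have "\<exists>z. x = fps_const (5 ^ a) * z"
    using assms
  proof induction
    case zero
    show ?case by (metis mult_zero_right)
  next
    case (step x j e c)
    from step.IH obtain z where z: "x = fps_const (5 ^ a) * z" ..
    have "5 ^ e = 5 ^ a * (5 :: int fps) ^ (e - a)"
      using step.hyps by (simp add: power_add[symmetric])
    also have "5 ^ a = (fps_const (5 ^ a) :: int fps)"
      by (simp add: numeral_fps_const fps_const_power)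
    finally have "x + of_int c * 5 ^ e * t_fps ^ j = fps_const (5 ^ a) * (z + of_int c * 5 ^ (e - a) * t_fps ^ j)"
      unfolding z by (simp only: distrib_left ac_simps)
    then show ?case ..
  qed
  then show ?thesis using that by blast
qed

text \<open>Generators with j >= 2 carry at least two factors of 5 beyond \<open>5 ^ a\<close>, so
  modulo \<open>5 ^ (a + 1)\<close> only the linear term in t remains.\<close>

lemma t_lattice_leading:
  assumes "t_lattice a 4 x"
  obtains c z where "x = fps_const (5 ^ a) * (fps_const c * t_fps + 5 * z)"
proof -
  have "\<exists>c z. x = fps_const (5 ^ a) * (fps_const c * t_fps + 5 * z)"
    using assms
  proof induction
    case zero
    have "0 = fps_const (5 ^ a) * (fps_const 0 * t_fps + 5 * 0)" by simp
    then show ?case by blast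
  next
    case (step x j e c)
    from step.IH obtain c' z where z: "x = fps_const (5 ^ a) * (fps_const c' * t_fps + 5 * z)" by blast
    have e: "5 ^ e = fps_const (5 ^ a) * (5 :: int fps) ^ (e - a)"
    proof -
      have "5 ^ e = 5 ^ a * (5 :: int fps) ^ (e - a)"
        using step.hyps by (simp add: power_add[symmetric])
      then show ?thesis by (simp add: numeral_fps_const fps_const_power)
    qed
    show ?case
    proof (cases "j = 1")
      case True
      have "x + of_int c * 5 ^ e * t_fps ^ j =
        fps_const (5 ^ a) * (fps_const (c' + c * 5 ^ (e - a)) * t_fps + 5 * z)"
        unfolding z e True
        by (simp add: algebra_simps numeral_fps_const fps_const_power fps_of_int[symmetric]
            fps_const_add[symmetric] del: fps_const_add)
      then show ?thesis by blast
    next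
      case False
      with step.hyps have "(5 * 2 - 4 - 1) div 2 \<le> (5 * j - 4 - 1) div 2"
        by (intro div_le_mono) simp
      with step.hyps have "e - a = Suc (e - a - 1)" by simp
      then have "(5 :: int fps) ^ (e - a) = 5 * 5 ^ (e - a - 1)" by (metis power_Suc)
      then have "x + of_int c * 5 ^ e * t_fps ^ j =
        fps_const (5 ^ a) * (fps_const c' * t_fps + 5 * (z + of_int c * 5 ^ (e - a - 1) * t_fps ^ j))"
        unfolding z e by (simp only: distrib_left ac_simps)
      then show ?thesis by blast
    qed
  qed
  then show ?thesis using that by blast
qed

text \<open>The shift by 1 makes room for the factors \<open>q ^ s\<close> that align the exponents before each step.\<close>

definition progression_fps :: "'a fps \<Rightarrow> nat \<Rightarrow> nat \<Rightarrow> 'a fps \<Rightarrow> bool" where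
  "progression_fps f d l Y \<longleftrightarrow> (\<forall>n. Y $ (n + 1) = f $ (d * n + l))"

lemma progression_fps_start: "progression_fps f 1 1 f"
  by (simp add: progression_fps_def)

text \<open>Coefficient n + 1 of the section is coefficient 5 (n + 1) - s = (5 n + (4 - s)) + 1 of
  \<open>Y\<close>.\<close>

lemma progression_fps_section:
  fixes f :: "'a :: comm_ring_1 fps"
  assumes "progression_fps f d l Y" "s \<le> 4"
  shows "progression_fps f (5 * d) ((4 - s) * d + l) (fps_section 5 (fps_X ^ s * Y))"
  unfolding progression_fps_def
proof
  fix n
  have "fps_section 5 (fps_X ^ s * Y) $ (n + 1) = Y $ ((5 * n + (4 - s)) + 1)"
  proof -
    have "5 * (n + 1) - s = 5 * n + (4 - s) + 1" "\<not> 5 * (n + 1) < s" using assms(2) by simp_all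
    then show ?thesis by (simp only: fps_nth_section fps_X_power_mult_nth if_False)
  qed
  also have "\<dots> = f $ (d * (5 * n + (4 - s)) + l)"
    using assms(1) unfolding progression_fps_def by blast
  finally show "fps_section 5 (fps_X ^ s * Y) $ (n + 1) = f $ (5 * d * n + ((4 - s) * d + l))"
    by (simp add: algebra_simps)
qed

lemma progression_fps_dvd:
  assumes "progression_fps f d l (g * x)" "t_lattice a k x"
  shows "5 ^ a dvd f $ (d * n + l)"
proof -
  obtain z where "x = fps_const (5 ^ a) * z" using assms(2) by (rule t_lattice_dvd)
  then have "g * x = fps_const (5 ^ a) * (g * z)" by (simp only: ac_simps)
  then have "(g * x) $ (n + 1) = 5 ^ a * (g * z) $ (n + 1)"
    by (simp only: fps_mult_left_const_nth)
  then show ?thesis using assms(1) by (simp add: progression_fps_def)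
qed

text \<open>From y = q E25 P1 follows q P1 = P25 y: the shift by q^s converts P1^s into y^s up to a
  series in q^5.\<close>

lemma X_partition_power: "(fps_X * P1) ^ s = fps_dilate 5 (P5 ^ s) * y_fps ^ s"
proof -
  have "P25 * y_fps = (E25 * P25) * (fps_X * P1)"
    unfolding y_fps_def B_part_def by (simp only: ac_simps)
  then show ?thesis
    by (simp add: euler_dilate_partition fps_dilate_power fps_dilate_dilate power_mult_distrib[symmetric])
qed

lemma section_partition_power:
  "fps_section 5 (fps_X ^ s * (fps_dilate 5 F * P1 ^ s * x)) = F * P5 ^ s * fps_section 5 (y_fps ^ s * x)"
proof -
  have "fps_X ^ s * (fps_dilate 5 F * P1 ^ s * x) = fps_dilate 5 F * (fps_X * P1) ^ s * x"
    unfolding power_mult_distrib by (simp only: ac_simps)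
  also have "\<dots> = fps_dilate 5 (F * P5 ^ s) * (y_fps ^ s * x)"
    unfolding X_partition_power fps_dilate_mult[OF zero_less_numeral] by (simp only: ac_simps)
  finally show ?thesis by (simp only: fps_section_dilate_mult zero_less_numeral)
qed

text \<open>The single step of all inductions below; \<open>s\<close> counts the factors
  \<open>P1\<close> and so decides which of the operators U, U y, U y^2 acts.\<close>

lemma progression_section_partition:
  assumes "progression_fps f d l (fps_dilate 5 F * P1 ^ s * x)" "s \<le> 4"
  shows "progression_fps f (5 * d) ((4 - s) * d + l) (F * P5 ^ s * fps_section 5 (y_fps ^ s * x))"
  using progression_fps_section[OF assms] by (simp only: section_partition_power)

section \<open>Iterated passage to progressions modulo 5\<close>

definition p1_fps_power :: "nat \<Rightarrow> int fps" where
  "p1_fps_power m = P1 * fps_dilate (5 ^ m) P1"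

lemma p1_fps_power_nth: "p1_fps_power m $ n = int (p1 (5 ^ m) n)"
  using arg_cong[OF p1_fps[of "5 ^ m", where 'a = int], of "\<lambda>f. f $ n"] by (simp add: p1_fps_power_def)

lemma dilate_5_dilate_power: "fps_dilate 5 (fps_dilate (5 ^ r) f) = fps_dilate (5 ^ Suc r) f"
  by (simp add: fps_dilate_dilate)

text \<open>Common start for both parities: after 2 k + 1 steps the second factor has lost that many
  dilations. Keeping \<open>r\<close> arbitrary lets the induction use up two more, and r = 0, 1
  give the odd and even powers of 5.\<close>

lemma odd_stage:
  "\<exists>x l. t_lattice (2 * k + 1) 4 x \<and> 24 * l = 19 * 5 ^ (2 * k + 1) + 1 \<and>
    (\<forall>r. progression_fps (p1_fps_power (2 * k + 1 + r)) (5 ^ (2 * k + 1)) l (fps_dilate (5 ^ r) P1 * P5 * x))"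
proof (induction k)
  case 0
  have "t_lattice 1 4 (of_int 1 * 5 ^ 1 * t_fps ^ 1)" by (rule t_lattice_gen) auto
  moreover have "progression_fps (p1_fps_power (1 + r)) 5 4 (fps_dilate (5 ^ r) P1 * P5 * (5 * t_fps))" for r
  proof -
    have "progression_fps (p1_fps_power (1 + r)) 1 1 (fps_dilate 5 (fps_dilate (5 ^ r) P1) * P1 ^ 1 * 1)"
      using progression_fps_start[of "p1_fps_power (1 + r)"]
      unfolding dilate_5_dilate_power by (simp add: p1_fps_power_def mult.commute)
    from progression_section_partition[OF this] section_y_small(1)
    show ?thesis by (simp add: section_y_def)
  qed
  ultimately show ?case by (intro exI[of _ "5 * t_fps"] exI[of _ 4]) simp
next
  case (Suc k)
  then obtain x l where x: "t_lattice (2 * k + 1) 4 x" and l: "24 * l = 19 * 5 ^ (2 * k + 1) + 1"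
    and r: "\<And>r. progression_fps (p1_fps_power (2 * k + 1 + r)) (5 ^ (2 * k + 1)) l
      (fps_dilate (5 ^ r) P1 * P5 * x)" by blast
  \<comment> \<open>A step with \<open>s = 0\<close> and then one with \<open>s = 1\<close>, each
    gaining a factor 5.\<close>
  define x' l' where "x' = fps_section 5 x" and "l' = 4 * 5 ^ (2 * k + 1) + l"
  define x'' l'' where "x'' = fps_section 5 (y_fps * x')" and "l'' = 3 * 5 ^ (2 * k + 2) + l'"
  have "t_lattice (2 * k + 2) 4 x'" using t_lattice_section_0[OF x] by (simp add: x'_def)
  then have "t_lattice (2 * Suc k + 1) 4 x''" using t_lattice_section_1 by (fastforce simp: x''_def)
  moreover have "24 * l'' = 19 * 5 ^ (2 * Suc k + 1) + 1"
    using l by (simp add: l''_def l'_def)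
  moreover have "progression_fps (p1_fps_power (2 * Suc k + 1 + r)) (5 ^ (2 * Suc k + 1)) l''
      (fps_dilate (5 ^ r) P1 * P5 * x'')" for r
  proof -
    have "fps_dilate 5 (fps_dilate (5 ^ Suc r) P1 * P1) = fps_dilate (5 ^ Suc (Suc r)) P1 * P5"
      by (simp add: fps_dilate_mult fps_dilate_dilate)
    then have "progression_fps (p1_fps_power (2 * k + 1 + Suc (Suc r))) (5 ^ (2 * k + 1)) l
      (fps_dilate 5 (fps_dilate (5 ^ Suc r) P1 * P1) * P1 ^ 0 * x)"
      using r[of "Suc (Suc r)"] by simp
    from progression_section_partition[OF this]
    have "progression_fps (p1_fps_power (2 * k + 1 + Suc (Suc r))) (5 ^ (2 * k + 2)) l'
      (fps_dilate 5 (fps_dilate (5 ^ r) P1) * P1 ^ 1 * x')"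
      by (simp add: x'_def l'_def fps_dilate_dilate)
    from progression_section_partition[OF this] show ?thesis
      by (simp add: x''_def l''_def)
  qed
  ultimately show ?case by blast
qed

text \<open>Once the second factor is used up, each step with \<open>s = 1\<close> reproduces the
  shape P1 P5 x and gains a factor 5.\<close>

lemma odd_power_stage:
  assumes "k \<ge> 1"
  shows "\<exists>x l. t_lattice (2 * k + \<beta> - 1) 4 x \<and> 24 * l = 18 * 5 ^ (2 * k + \<beta> - 1) + 5 ^ (2 * k - 1) + 1 \<and>
    progression_fps (p1_fps_power (2 * k - 1)) (5 ^ (2 * k + \<beta> - 1)) l (P1 * P5 * x)"
proof (induction \<beta>)
  case 0
  have k: "2 * (k - 1) + 1 = 2 * k - 1" using assms by simp
  from odd_stage[of "k - 1"] obtain x l where "t_lattice (2 * k - 1) 4 x" "24 * l = 19 * 5 ^ (2 * k - 1) + 1"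
    "\<And>r. progression_fps (p1_fps_power (2 * k - 1 + r)) (5 ^ (2 * k - 1)) l (fps_dilate (5 ^ r) P1 * P5 * x)"
    unfolding k by blast
  from this(1,2) this(3)[of 0] show ?case
    by (intro exI[of _ x] exI[of _ l]) (simp add: fps_dilate_one[unfolded One_nat_def])
next
  case (Suc \<beta>)
  then obtain x l where x: "t_lattice (2 * k + \<beta> - 1) 4 x"
    and l: "24 * l = 18 * 5 ^ (2 * k + \<beta> - 1) + 5 ^ (2 * k - 1) + 1"
    and p: "progression_fps (p1_fps_power (2 * k - 1)) (5 ^ (2 * k + \<beta> - 1)) l (P1 * P5 * x)"
    by blast
  have k: "2 * k + Suc \<beta> - 1 = Suc (2 * k + \<beta> - 1)" using assms by simp
  from p have "progression_fps (p1_fps_power (2 * k - 1)) (5 ^ (2 * k + \<beta> - 1)) l (fps_dilate 5 P1 * P1 ^ 1 * x)"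
    by (simp add: mult.commute)
  from progression_section_partition[OF this]
  have "progression_fps (p1_fps_power (2 * k - 1)) (5 ^ (2 * k + Suc \<beta> - 1)) (3 * 5 ^ (2 * k + \<beta> - 1) + l)
    (P1 * P5 * fps_section 5 (y_fps * x))"
    unfolding k by simp
  moreover have "24 * (3 * 5 ^ (2 * k + \<beta> - 1) + l) = 18 * 5 ^ (2 * k + Suc \<beta> - 1) + 5 ^ (2 * k - 1) + 1"
    using l unfolding k by simp
  moreover have "t_lattice (2 * k + Suc \<beta> - 1) 4 (fps_section 5 (y_fps * x))"
    using t_lattice_section_1[OF x] unfolding k by simp
  ultimately show ?case by blast
qed

text \<open>\<open>P5 * P5\<close> is a series in q^5, so the step has \<open>s = 0\<close> and
  gains a factor 5.\<close>

lemma even_power_stage_step: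
  assumes "k \<ge> 1"
    and "\<exists>x l. t_lattice (2 * k + \<beta> - 1) 4 x \<and> 24 * l = 14 * 5 ^ (2 * k + 2 * \<beta> - 1) + 5 ^ (2 * k) + 1 \<and>
      progression_fps (p1_fps_power (2 * k)) (5 ^ (2 * k + 2 * \<beta> - 1)) l (P5 * P5 * x)"
  shows "\<exists>x l. t_lattice (2 * k + \<beta>) 4 x \<and> 24 * l = 22 * 5 ^ (2 * k + 2 * \<beta>) + 5 ^ (2 * k) + 1 \<and>
    progression_fps (p1_fps_power (2 * k)) (5 ^ (2 * k + 2 * \<beta>)) l (P1 * P1 * x)"
proof -
  from assms(2) obtain x l where x: "t_lattice (2 * k + \<beta> - 1) 4 x"
    and l: "24 * l = 14 * 5 ^ (2 * k + 2 * \<beta> - 1) + 5 ^ (2 * k) + 1"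
    and p: "progression_fps (p1_fps_power (2 * k)) (5 ^ (2 * k + 2 * \<beta> - 1)) l (P5 * P5 * x)" by blast
  have k: "2 * k + 2 * \<beta> = Suc (2 * k + 2 * \<beta> - 1)" "2 * k + \<beta> = 2 * k + \<beta> - 1 + 1"
    using assms(1) by simp_all
  from p have "progression_fps (p1_fps_power (2 * k)) (5 ^ (2 * k + 2 * \<beta> - 1)) l
    (fps_dilate 5 (P1 * P1) * P1 ^ 0 * x)"
    by (simp add: fps_dilate_mult)
  from progression_section_partition[OF this]
  have "progression_fps (p1_fps_power (2 * k)) (5 ^ (2 * k + 2 * \<beta>)) (4 * 5 ^ (2 * k + 2 * \<beta> - 1) + l)
    (P1 * P1 * fps_section 5 x)"
    by (subst k(1)) simp
  moreover have "24 * (4 * 5 ^ (2 * k + 2 * \<beta> - 1) + l) = 22 * 5 ^ (2 * k + 2 * \<beta>) + 5 ^ (2 * k) + 1"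
    using l by (subst k(1)) simp
  moreover have "t_lattice (2 * k + \<beta>) 4 (fps_section 5 x)"
    using t_lattice_section_0[OF x] k(2) by simp
  ultimately show ?thesis by blast
qed

text \<open>The shapes P5^2 x and P1^2 x alternate. The step back to P5^2 has \<open>s = 2\<close>
  and gains nothing, hence one factor 5 for every two steps.\<close>

lemma even_power_stage_odd:
  assumes "k \<ge> 1"
  shows "\<exists>x l. t_lattice (2 * k + \<beta> - 1) 4 x \<and> 24 * l = 14 * 5 ^ (2 * k + 2 * \<beta> - 1) + 5 ^ (2 * k) + 1 \<and>
      progression_fps (p1_fps_power (2 * k)) (5 ^ (2 * k + 2 * \<beta> - 1)) l (P5 * P5 * x)"
proof (induction \<beta>)
  case 0
  have k: "2 * (k - 1) + 1 = 2 * k - 1" using assms by simp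
  from odd_stage[of "k - 1"] obtain x l where x: "t_lattice (2 * k - 1) 4 x"
    and l: "24 * l = 19 * 5 ^ (2 * k - 1) + 1"
    and p: "\<And>r. progression_fps (p1_fps_power (2 * k - 1 + r)) (5 ^ (2 * k - 1)) l
      (fps_dilate (5 ^ r) P1 * P5 * x)"
    unfolding k by blast
  have k': "2 * k = Suc (2 * k - 1)" using assms by simp
  then have "(5 :: nat) ^ (2 * k) = 5 * 5 ^ (2 * k - 1)" by (metis power_Suc)
  \<comment> \<open>19 = 14 + 5, and the 5 is absorbed into \<open>5 ^ (2 * k)\<close>.\<close>
  with l have "24 * l = 14 * 5 ^ (2 * k - 1) + 5 ^ (2 * k) + 1" by simp
  with x p[of 1] k' show ?case by (intro exI[of _ x] exI[of _ l]) simp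
next
  case (Suc \<beta>)
  then obtain x l where x: "t_lattice (2 * k + \<beta>) 4 x"
    and l: "24 * l = 22 * 5 ^ (2 * k + 2 * \<beta>) + 5 ^ (2 * k) + 1"
    and p: "progression_fps (p1_fps_power (2 * k)) (5 ^ (2 * k + 2 * \<beta>)) l (P1 * P1 * x)"
    using even_power_stage_step[OF assms] by blast
  have k: "2 * k + 2 * Suc \<beta> - 1 = Suc (2 * k + 2 * \<beta>)" "2 * k + Suc \<beta> - 1 = 2 * k + \<beta>" by simp_all
  from p have "progression_fps (p1_fps_power (2 * k)) (5 ^ (2 * k + 2 * \<beta>)) l
    (fps_dilate 5 1 * P1 ^ 2 * x)"
    by (simp add: power2_eq_square)
  from progression_section_partition[OF this]
  have "progression_fps (p1_fps_power (2 * k)) (5 ^ (2 * k + 2 * Suc \<beta> - 1)) (2 * 5 ^ (2 * k + 2 * \<beta>) + l)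
    (P5 * P5 * fps_section 5 (y_fps ^ 2 * x))"
    unfolding k by (simp add: power2_eq_square)
  moreover have "24 * (2 * 5 ^ (2 * k + 2 * \<beta>) + l) = 14 * 5 ^ (2 * k + 2 * Suc \<beta> - 1) + 5 ^ (2 * k) + 1"
    using l unfolding k by simp
  ultimately show ?case using t_lattice_section_2[OF x] unfolding k by blast
qed

lemmas even_power_stage_even = even_power_stage_step[OF _ even_power_stage_odd]

text \<open>Modulo 5, t is y, and y P1 is D b E^3 with D a series in q^5. By the dissection b E^3
  has exponents only in the classes 1 and 2 modulo 5, up to a multiple of 5.\<close>

lemma t_partition_mod_5:
  obtains f1 f2 g where "P1 * P5 * t_fps = f1 + f2 + 5 * g" "fps_supp 1 f1" "fps_supp 2 f2"
proof -
  define A b C where "A = A_part" and "b = B_part" and "C = C_part"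
  have E: "E1 = A - b + C" and AC: "A * C = - (b ^ 2)"
    unfolding A_def b_def C_def by (rule euler_dissection, rule A_mult_C)
  have EP: "E1 * P1 = 1" by (rule euler_partition_fps)
  define D where "D = fps_dilate 5 (E5 * P1 ^ 6)"
  have D: "D = E25 * P5 ^ 6"
    by (simp add: D_def fps_dilate_mult fps_dilate_power fps_dilate_dilate)
  define Y where "Y = y_fps + 3 * y_fps ^ 2 + 5 * y_fps ^ 3 + 5 * y_fps ^ 4"
  have t: "t_fps = y_fps * (1 + 5 * Y)"
    unfolding t_eq_y y_quartic_def Y_def by (simp add: algebra_simps)
  have "y_fps * P1 = D * b * E1 ^ 3 + 5 * (D * b * (E1 ^ 2 * b + 3 * E1 * b ^ 2 + 5 * b ^ 3 + 5 * b ^ 4 * P1))"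
  proof -
    have y: "y_fps = b * P1" by (simp add: y_fps_def b_def)
    have "y_fps = D * y_fps * (1 + 5 * y_fps + 15 * y_fps ^ 2 + 25 * y_fps ^ 3 + 25 * y_fps ^ 4) * E1 ^ 5"
      using y_via_dilate unfolding D y_quartic_def .
    then show ?thesis using EP unfolding y by Groebner_Basis.algebra
  qed
  then obtain h where h: "y_fps * P1 = D * b * E1 ^ 3 + 5 * h" by blast
  have E3: "b * E1 ^ 3 = (b * A ^ 3 - 3 * (b ^ 2 * C ^ 2)) + (b * C ^ 3 - 3 * (b ^ 2 * A ^ 2)) + 5 * b ^ 4"
    using E AC by Groebner_Basis.algebra
  have "P1 * P5 * t_fps = P5 * (y_fps * P1) + 5 * (P1 * P5 * y_fps * Y)"
    unfolding t by (simp add: algebra_simps)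
  also have "\<dots> = P5 * D * (b * E1 ^ 3) + 5 * (P5 * h + P1 * P5 * y_fps * Y)"
    unfolding h by (simp add: algebra_simps)
  also have "\<dots> = P5 * D * (b * A ^ 3 - 3 * (b ^ 2 * C ^ 2)) + P5 * D * (b * C ^ 3 - 3 * (b ^ 2 * A ^ 2))
    + 5 * (P5 * D * b ^ 4 + P5 * h + P1 * P5 * y_fps * Y)"
    unfolding E3 by (simp add: algebra_simps)
  finally have *: "P1 * P5 * t_fps = \<dots>" .
  have PD: "fps_supp 0 (P5 * D)"
    using fps_supp_mult[OF fps_supp_dilate[of 5] fps_supp_dilate[of 5], of P1 "E5 * P1 ^ 6"] by (simp add: D_def)
  have diff: "fps_supp r (f - 3 * g)" if "fps_supp r f" "fps_supp s g" "r mod 5 = s mod 5"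
    for r s and f g :: "int fps"
    unfolding fps_supp_def
  proof (intro allI impI)
    fix n assume "(f - 3 * g) $ n \<noteq> 0"
    then have "f $ n \<noteq> 0 \<or> g $ n \<noteq> 0" by (auto simp: numeral_fps_const)
    then show "n mod 5 = r mod 5" using that unfolding fps_supp_def by metis
  qed
  have "fps_supp 1 (b * A ^ 3)" "fps_supp 6 (b ^ 2 * C ^ 2)" "fps_supp 7 (b * C ^ 3)" "fps_supp 2 (b ^ 2 * A ^ 2)"
    using fps_supp_mult[OF fps_supp_B_part fps_supp_power[OF fps_supp_A_part, of 3]]
      fps_supp_mult[OF fps_supp_power[OF fps_supp_B_part, of 2] fps_supp_power[OF fps_supp_C_part, of 2]]
      fps_supp_mult[OF fps_supp_B_part fps_supp_power[OF fps_supp_C_part, of 3]]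
      fps_supp_mult[OF fps_supp_power[OF fps_supp_B_part, of 2] fps_supp_power[OF fps_supp_A_part, of 2]]
    by (simp_all add: A_def b_def C_def)
  then have "fps_supp 1 (b * A ^ 3 - 3 * (b ^ 2 * C ^ 2))" "fps_supp 7 (b * C ^ 3 - 3 * (b ^ 2 * A ^ 2))"
    by (auto intro: diff)
  from fps_supp_mult[OF PD this(1)] fps_supp_mult[OF PD this(2)]
  have "fps_supp 1 (P5 * D * (b * A ^ 3 - 3 * (b ^ 2 * C ^ 2)))"
    "fps_supp 2 (P5 * D * (b * C ^ 3 - 3 * (b ^ 2 * A ^ 2)))"
    by (simp_all add: fps_supp_def)
  with * show ?thesis by (rule that)
qed

lemma t_partition_nth_dvd_5:
  assumes "n mod 5 \<noteq> 1" "n mod 5 \<noteq> 2"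
  shows "5 dvd (P1 * P5 * t_fps) $ n"
proof -
  obtain f1 f2 g where "P1 * P5 * t_fps = f1 + f2 + 5 * g" "fps_supp 1 f1" "fps_supp 2 f2"
    by (rule t_partition_mod_5)
  moreover from this assms have "f1 $ n = 0" "f2 $ n = 0" by (auto simp: fps_supp_def)
  ultimately show ?thesis by (simp add: numeral_fps_const)
qed

text \<open>Because of the shift by 1, the residue \<open>r\<close> reads coefficients of class r +
  1, that is 3, 4 or 0, where the linear term from \<open>t_lattice_leading\<close> yields one more
  factor 5.\<close>

lemma progression_fps_dvd_residue:
  assumes "progression_fps f d l (P1 * P5 * x)" "t_lattice a 4 x" "r \<in> {2, 3, 4}"
  shows "5 ^ (a + 1) dvd f $ (5 * d * n + (r * d + l))"
proof -
  obtain c z where "x = fps_const (5 ^ a) * (fps_const c * t_fps + 5 * z)"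
    using assms(2) by (rule t_lattice_leading)
  then have "P1 * P5 * x = fps_const (5 ^ a) * (fps_const c * (P1 * P5 * t_fps) + fps_const 5 * (P1 * P5 * z))"
    by (simp only: distrib_left ac_simps numeral_fps_const)
  then have "(P1 * P5 * x) $ (5 * n + r + 1) =
    5 ^ a * (c * (P1 * P5 * t_fps) $ (5 * n + r + 1) + 5 * (P1 * P5 * z) $ (5 * n + r + 1))"
    by simp
  moreover have "5 dvd (P1 * P5 * t_fps) $ (5 * n + r + 1)"
    by (rule t_partition_nth_dvd_5) (use assms(3) in \<open>auto simp: mod_Suc\<close>)
  ultimately have "5 ^ a * 5 dvd (P1 * P5 * x) $ (5 * n + r + 1)"
    by (metis dvd_add dvd_mult dvd_triv_left mult_dvd_mono dvd_refl)
  moreover have "(P1 * P5 * x) $ (5 * n + r + 1) = f $ (d * (5 * n + r) + l)"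
    using assms(1) unfolding progression_fps_def by blast
  ultimately show ?thesis by (simp add: algebra_simps)
qed

lemma p1_congI:
  assumes "5 ^ a dvd p1_fps_power m $ (d + l)" "24 * l = u"
  shows "[p1 (5 ^ m) (d + u div 24) = 0] (mod 5 ^ a)"
proof -
  have "u div 24 = l" using assms(2) by simp
  moreover have "int (5 ^ a) dvd int (p1 (5 ^ m) (d + l))"
    using assms(1) by (simp add: p1_fps_power_nth)
  ultimately show ?thesis by (simp only: cong_0_iff int_dvd_int_iff)
qed

theorem theorem1p1:
  fixes n \<beta> k :: nat
  assumes "k \<ge> 1"
  shows "[p1 (5 ^ (2*k - 1))
            (5 ^ (2*k + \<beta> - 1) * n
              + (18 * 5 ^ (2*k + \<beta> - 1) + 5 ^ (2*k - 1) + 1) div 24) = 0]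
          (mod 5 ^ (2*k + \<beta> - 1))
    \<and> [p1 (5 ^ (2*k))
            (5 ^ (2*k + 2*\<beta> - 1) * n
              + (14 * 5 ^ (2*k + 2*\<beta> - 1) + 5 ^ (2*k) + 1) div 24) = 0]
          (mod 5 ^ (2*k + \<beta> - 1))
    \<and> [p1 (5 ^ (2*k))
            (5 ^ (2*k + 2*\<beta>) * n
              + (22 * 5 ^ (2*k + 2*\<beta>) + 5 ^ (2*k) + 1) div 24) = 0]
          (mod 5 ^ (2*k + \<beta>))
    \<and> (\<forall>r \<in> {2, 3, 4 :: nat}.
          [p1 (5 ^ (2*k - 1))
            (5 ^ (2*k + \<beta>) * n
              + ((24*r + 18) * 5 ^ (2*k + \<beta> - 1) + 5 ^ (2*k - 1) + 1) div 24) = 0]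
          (mod 5 ^ (2*k + \<beta>)))
    \<and> [p1 (5 ^ (2*k))
            (5 ^ (2*k + 2*\<beta> + 2) * n
              + (22 * 5 ^ (2*k + 2*\<beta> + 2) + 5 ^ (2*k) + 1) div 24) = 0]
          (mod 5 ^ (2*k + \<beta> + 1))"
proof (intro conjI ballI)
  obtain x l where x: "t_lattice (2*k + \<beta> - 1) 4 x"
    and l: "24 * l = 18 * 5 ^ (2*k + \<beta> - 1) + 5 ^ (2*k - 1) + 1"
    and p: "progression_fps (p1_fps_power (2*k - 1)) (5 ^ (2*k + \<beta> - 1)) l (P1 * P5 * x)"
    using odd_power_stage[OF assms] by blast
  show "[p1 (5 ^ (2*k - 1))
            (5 ^ (2*k + \<beta> - 1) * n
              + (18 * 5 ^ (2*k + \<beta> - 1) + 5 ^ (2*k - 1) + 1) div 24) = 0]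
          (mod 5 ^ (2*k + \<beta> - 1))"
    by (rule p1_congI[OF progression_fps_dvd[OF p x] l])
  fix r :: nat assume r: "r \<in> {2, 3, 4}"
  have k: "2*k + \<beta> = (2*k + \<beta> - 1) + 1" using assms by simp
  have pow: "(5 :: nat) ^ (2*k + \<beta>) = 5 * 5 ^ (2*k + \<beta> - 1)" by (subst k) simp
  \<comment> \<open>The offset of the subprogression 5 n + r of the first progression.\<close>
  have l': "24 * (r * 5 ^ (2*k + \<beta> - 1) + l) = (24*r + 18) * 5 ^ (2*k + \<beta> - 1) + 5 ^ (2*k - 1) + 1"
    using l by (simp add: algebra_simps)
  have "5 ^ (2*k + \<beta>) dvd p1_fps_power (2*k - 1) $ (5 ^ (2*k + \<beta>) * n + (r * 5 ^ (2*k + \<beta> - 1) + l))"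
    using progression_fps_dvd_residue[OF p x r, of n] unfolding k[symmetric] pow[symmetric] .
  then show "[p1 (5 ^ (2*k - 1))
            (5 ^ (2*k + \<beta>) * n
              + ((24*r + 18) * 5 ^ (2*k + \<beta> - 1) + 5 ^ (2*k - 1) + 1) div 24) = 0]
          (mod 5 ^ (2*k + \<beta>))"
    by (rule p1_congI[OF _ l'])
next
  show "[p1 (5 ^ (2*k))
            (5 ^ (2*k + 2*\<beta> - 1) * n
              + (14 * 5 ^ (2*k + 2*\<beta> - 1) + 5 ^ (2*k) + 1) div 24) = 0]
          (mod 5 ^ (2*k + \<beta> - 1))"
    using even_power_stage_odd[OF assms, of \<beta>] by (blast intro: p1_congI progression_fps_dvd)
  \<comment> \<open>Taken at \<beta> and at \<beta> + 1, this gives the third and the fifth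
    congruence.\<close>
  have even: "[p1 (5 ^ (2*k))
            (5 ^ (2*k + 2*\<gamma>) * n
              + (22 * 5 ^ (2*k + 2*\<gamma>) + 5 ^ (2*k) + 1) div 24) = 0]
          (mod 5 ^ (2*k + \<gamma>))" for \<gamma>
    using even_power_stage_even[OF assms assms, of \<gamma>] by (blast intro: p1_congI progression_fps_dvd)
  show "[p1 (5 ^ (2*k))
            (5 ^ (2*k + 2*\<beta>) * n
              + (22 * 5 ^ (2*k + 2*\<beta>) + 5 ^ (2*k) + 1) div 24) = 0]
          (mod 5 ^ (2*k + \<beta>))"
    by (rule even)
  show "[p1 (5 ^ (2*k))
            (5 ^ (2*k + 2*\<beta> + 2) * n
              + (22 * 5 ^ (2*k + 2*\<beta> + 2) + 5 ^ (2*k) + 1) div 24) = 0]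
          (mod 5 ^ (2*k + \<beta> + 1))"
    using even[of "Suc \<beta>"] by (simp only: Suc_eq_plus1 distrib_left mult_1_right add.assoc)
qed

end
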